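(* Let $K(\varepsilon)$ be a real symmetric $n\times n$ analytic matrix perturbation of the form $$K(\varepsilon)=\Delta(\varepsilon)\,(H+o(1))\,\Delta(\varepsilon)\qquad(\varepsilon\to0),$$ where $H$ is a constant real symmetric matrix and $\Delta(\varepsilon)=\mathrm{diag}(\varepsilon^{\nu_0}I_{b_0},\varepsilon^{\nu_1}I_{b_1},\dots,\varepsilon^{\nu_p}I_{b_p})$ with (not necessarily integer) exponents $\nu_0<\nu_1<\dots<\nu_p$ and positive integers $b_0,\dots,b_p$, $\sum_i b_i=n$. Partition $H=(H_{i,k})_{i,k=0}^p$ into blocks $H_{i,k}\in\mathbb R^{b_i\times b_k}$. Assume that, for some $j\le p$, the matrix $H_{\le j,\le j}$ is invertible (i.e., all Schur complements up to $S_j$ exist). Then: 1. The asymptotic spectral equivalent of $K$ truncated at order $2\nu_j$ has the block-diagonal form $$\mathrm{trunc}_{2\nu_j}\,\underline{K}(\varepsilon)=\mathrm{diag}\big(\varepsilon^{2\nu_0}S_0,\ \dots,\ \varepsilon^{2\nu_j}S_j,\ 0\big).$$ 2. If $H$ is invertible (i.e., $j=p$), the asymptotic spectral equivalent is completely determined by $H$: $$\underline{K}(\varepsilon)=\mathrm{diag}\big(\varepsilon^{2\nu_0}S_0,\ \varepsilon^{2\nu_1}S_1,\ \dots,\ \varepsilon^{2\nu_p}S_p\big).$$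
   Context: Schur complements: $H_{\le i,\le k}$ is the submatrix of $H$ made of block rows $0,\dots,i$ and block columns $0,\dots,k$; $H_{<i,<i}=H_{\le i-1,\le i-1}$; $H_{i,<i}=(H_{i,0}\ \cdots\ H_{i,i-1})$; $H_{<i,i}=H_{i,<i}^{T}$. Put $S_0=H_{0,0}$ and, whenever $H_{<i,<i}$ is invertible, $S_i=H_{i,i}-H_{i,<i}(H_{<i,<i})^{-1}H_{<i,i}$. If some $S_i$ is not invertible, the sequence of Schur complements stops at this $S_i$. Asymptotic spectral equivalent (ASE): let $K(\varepsilon)=\sum_{k\ge0}K_k\varepsilon^k$ be a real symmetric $n\times n$ matrix, analytic near $\varepsilon=0$. By Rellich's theorem there are eigenvalues $\lambda_k(\varepsilon)$ and orthonormal eigenvectors $u_k(\varepsilon)$, $k=1,\dots,n$, analytic near $0$. If $\lambda_k\not\equiv0$, write $\lambda_k(\varepsilon)=\varepsilon^{\alpha}(\tilde\lambda_k+O(\varepsilon))$ with $\tilde\lambda_k\ne0$; $\alpha$ is the valuation and $\mathrm{lt}(\lambda_k)=\tilde\lambda_k\varepsilon^{\alpha}$ the leading term; if $\lambda_k\equiv0$, set $\mathrm{lt}(\lambda_k)=0$ and valuation $\infty$. With $\tilde u_k=u_k(0)$, the ASE is $\underline K(\varepsilon)=\sum_k \mathrm{lt}(\lambda_k)(\varepsilon)\,\tilde u_k\tilde u_k^T$ (independent of the choice of decomposition). Its truncation $\mathrm{trunc}_s\,\underline K(\varepsilon)$ keeps only the terms whose valuation is $\le s$. *)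

theory Defs
  imports
    Complex_Main
    "HOL-Library.Extended_Real"
    "HOL-Library.Landau_Symbols"
    "Jordan_Normal_Form.Matrix"
    "Jordan_Normal_Form.DL_Submatrix"
    "Jordan_Normal_Form.Gauss_Jordan_Elimination"
begin

section \<open>Block structure and Schur complements\<close>

text \<open>Block sizes are \<open>b 0, ..., b p\<close>; block \<open>i\<close> occupies the indices from
  \<open>offset b i\<close> up to (excluding) \<open>offset b (Suc i)\<close>, so the total size is
  \<open>offset b (Suc p)\<close>.\<close>

definition offset :: "(nat \<Rightarrow> nat) \<Rightarrow> nat \<Rightarrow> nat" where
  "offset b i = (\<Sum>l<i. b l)"

definition block_indices :: "(nat \<Rightarrow> nat) \<Rightarrow> nat \<Rightarrow> nat set" where
  "block_indices b i = {offset b i ..< offset b (Suc i)}"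

definition block :: "(nat \<Rightarrow> nat) \<Rightarrow> real mat \<Rightarrow> nat \<Rightarrow> nat \<Rightarrow> real mat" where
  "block b H i k = submatrix H (block_indices b i) (block_indices b k)"

text \<open>\<open>H\<^bsub>\<le>i,\<le>k\<^esub>\<close>, \<open>H\<^bsub><i,<i\<^esub>\<close> and \<open>H\<^bsub>i,<i\<^esub>\<close>, respectively.\<close>

definition block_le :: "(nat \<Rightarrow> nat) \<Rightarrow> real mat \<Rightarrow> nat \<Rightarrow> nat \<Rightarrow> real mat" where
  "block_le b H i k = submatrix H {..<offset b (Suc i)} {..<offset b (Suc k)}"

definition block_lt :: "(nat \<Rightarrow> nat) \<Rightarrow> real mat \<Rightarrow> nat \<Rightarrow> real mat" where
  "block_lt b H i = submatrix H {..<offset b i} {..<offset b i}"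

definition block_row_lt :: "(nat \<Rightarrow> nat) \<Rightarrow> real mat \<Rightarrow> nat \<Rightarrow> real mat" where
  "block_row_lt b H i = submatrix H (block_indices b i) {..<offset b i}"

definition schur_exists :: "(nat \<Rightarrow> nat) \<Rightarrow> real mat \<Rightarrow> nat \<Rightarrow> bool" where
  "schur_exists b H i \<longleftrightarrow> i = 0 \<or> invertible_mat (block_lt b H i)"

text \<open>Only meaningful when \<open>schur_exists b H i\<close> holds.\<close>

definition schur_complement :: "(nat \<Rightarrow> nat) \<Rightarrow> real mat \<Rightarrow> nat \<Rightarrow> real mat" where
  "schur_complement b H i =
     (if i = 0 then block b H 0 0
      else block b H i i -
        block_row_lt b H i * the (mat_inverse (block_lt b H i)) * transpose_mat (block_row_lt b H i))"


section \<open>Analytic symmetric perturbations\<close>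

definition analytic_at_zero :: "(real \<Rightarrow> real) \<Rightarrow> bool" where
  "analytic_at_zero f \<longleftrightarrow>
     (\<exists>a. \<exists>r>0. \<forall>\<epsilon>. \<bar>\<epsilon>\<bar> < r \<longrightarrow> (\<lambda>k. a k * \<epsilon> ^ k) sums f \<epsilon>)"

definition analytic_symmetric :: "nat \<Rightarrow> (real \<Rightarrow> real mat) \<Rightarrow> bool" where
  "analytic_symmetric n K \<longleftrightarrow>
     (\<forall>\<^sub>F \<epsilon> in nhds 0. K \<epsilon> \<in> carrier_mat n n \<and> transpose_mat (K \<epsilon>) = K \<epsilon>) \<and>
     (\<forall>r<n. \<forall>c<n. analytic_at_zero (\<lambda>\<epsilon>. K \<epsilon> $$ (r, c)))"

definition scaling_mat :: "nat \<Rightarrow> (nat \<Rightarrow> real) \<Rightarrow> (nat \<Rightarrow> nat) \<Rightarrow> real \<Rightarrow> real mat" where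
  "scaling_mat p \<nu> b \<epsilon> = diag_block_mat (map (\<lambda>i. (\<epsilon> powr \<nu> i) \<cdot>\<^sub>m 1\<^sub>m (b i)) [0..<Suc p])"

text \<open>\<open>K(\<epsilon>) = \<Delta>(\<epsilon>) (H + o(1)) \<Delta>(\<epsilon>)\<close>. As the exponents \<open>\<nu> i\<close> are arbitrary reals, the
  factorization is only meaningful for \<open>\<epsilon> > 0\<close>, i.e. as \<open>\<epsilon>\<close> tends to 0 from the right.\<close>

definition scaled_form ::
    "nat \<Rightarrow> (nat \<Rightarrow> real) \<Rightarrow> (nat \<Rightarrow> nat) \<Rightarrow> real mat \<Rightarrow> (real \<Rightarrow> real mat) \<Rightarrow> bool" where
  "scaled_form p \<nu> b H K \<longleftrightarrow>
     (let n = offset b (Suc p) in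
      \<exists>R. (\<forall>\<epsilon>. R \<epsilon> \<in> carrier_mat n n) \<and>
          (\<forall>r<n. \<forall>c<n. ((\<lambda>\<epsilon>. R \<epsilon> $$ (r, c)) \<longlongrightarrow> 0) (at_right 0)) \<and>
          (\<forall>\<^sub>F \<epsilon> in at_right 0. K \<epsilon> = scaling_mat p \<nu> b \<epsilon> * (H + R \<epsilon>) * scaling_mat p \<nu> b \<epsilon>))"


section \<open>The asymptotic spectral equivalent\<close>

text \<open>An analytic spectral decomposition as provided by Rellich's theorem, with eigenvalues
  and eigenvectors indexed by \<open>k < n\<close>.\<close>

definition analytic_spectral_decomposition ::
    "nat \<Rightarrow> (real \<Rightarrow> real mat) \<Rightarrow> (nat \<Rightarrow> real \<Rightarrow> real) \<Rightarrow> (nat \<Rightarrow> real \<Rightarrow> real vec) \<Rightarrow> bool" where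
  "analytic_spectral_decomposition n K lam u \<longleftrightarrow>
     (\<forall>k<n. analytic_at_zero (lam k)) \<and>
     (\<forall>k<n. \<forall>r<n. analytic_at_zero (\<lambda>\<epsilon>. u k \<epsilon> $ r)) \<and>
     (\<forall>\<^sub>F \<epsilon> in nhds 0.
        (\<forall>k<n. u k \<epsilon> \<in> carrier_vec n \<and> K \<epsilon> *\<^sub>v u k \<epsilon> = lam k \<epsilon> \<cdot>\<^sub>v u k \<epsilon>) \<and>
        (\<forall>k<n. \<forall>l<n. u k \<epsilon> \<bullet> u l \<epsilon> = (if k = l then 1 else 0)))"

definition vanishes_near_zero :: "(real \<Rightarrow> real) \<Rightarrow> bool" where
  "vanishes_near_zero f \<longleftrightarrow> (\<forall>\<^sub>F \<epsilon> in nhds 0. f \<epsilon> = 0)"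

text \<open>\<open>f(\<epsilon>) = \<epsilon>\<^sup>\<alpha> (c + O(\<epsilon>))\<close> with \<open>c \<noteq> 0\<close>; for an analytic \<open>f\<close> that does not vanish
  identically near 0, the pair of \<open>\<alpha>\<close> and \<open>c\<close> exists and is unique.\<close>

definition leading_form :: "(real \<Rightarrow> real) \<Rightarrow> nat \<Rightarrow> real \<Rightarrow> bool" where
  "leading_form f \<alpha> c \<longleftrightarrow> c \<noteq> 0 \<and>
     (\<exists>g. g \<in> O[at 0](\<lambda>\<epsilon>. \<epsilon>) \<and> (\<forall>\<^sub>F \<epsilon> in at 0. f \<epsilon> = \<epsilon> ^ \<alpha> * (c + g \<epsilon>)))"

definition valuation :: "(real \<Rightarrow> real) \<Rightarrow> enat" where
  "valuation f = (if vanishes_near_zero f then \<infinity> else enat (THE \<alpha>. \<exists>c. leading_form f \<alpha> c))"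

definition leading_term :: "(real \<Rightarrow> real) \<Rightarrow> real \<Rightarrow> real" where
  "leading_term f \<epsilon> =
     (if vanishes_near_zero f then 0
      else (THE c. \<exists>\<alpha>. leading_form f \<alpha> c) * \<epsilon> ^ (THE \<alpha>. \<exists>c. leading_form f \<alpha> c))"

text \<open>The asymptotic spectral equivalent and its truncation, expressed through a spectral
  decomposition \<open>lam\<close>, \<open>u\<close> of the perturbation. The value does not depend on the
  decomposition; theorems should quantify over all decompositions.\<close>

definition ase ::
    "nat \<Rightarrow> (nat \<Rightarrow> real \<Rightarrow> real) \<Rightarrow> (nat \<Rightarrow> real \<Rightarrow> real vec) \<Rightarrow> real \<Rightarrow> real mat" where
  "ase n lam u \<epsilon> =
     mat n n (\<lambda>(r, c). \<Sum>k | k < n. leading_term (lam k) \<epsilon> * (u k 0 $ r * u k 0 $ c))"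

definition trunc_ase ::
    "real \<Rightarrow> nat \<Rightarrow> (nat \<Rightarrow> real \<Rightarrow> real) \<Rightarrow> (nat \<Rightarrow> real \<Rightarrow> real vec) \<Rightarrow> real \<Rightarrow> real mat" where
  "trunc_ase s n lam u \<epsilon> =
     mat n n (\<lambda>(r, c). \<Sum>k | k < n \<and> ereal_of_enat (valuation (lam k)) \<le> ereal s.
       leading_term (lam k) \<epsilon> * (u k 0 $ r * u k 0 $ c))"

end

theory Submission
  imports Defs "Jordan_Normal_Form.Determinant"
begin

text \<open>
  Let \<open>(\<lambda>, u)\<close> be an analytic eigenpair with \<open>\<lambda> = \<epsilon>\<^sup>\<alpha> (c + o(1))\<close>, and let \<open>i\<close> be least with
  \<open>\<alpha> \<le> 2 \<nu>\<^sub>i\<close>. In terms of \<open>x = \<Delta> u\<close> the eigenvalue equation reads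
  \<open>(H + o(1)) x = \<lambda> \<Delta>\<^sup>-\<^sup>2 x\<close>. In the block rows below \<open>i\<close> the factor \<open>\<lambda> \<Delta>\<^sup>-\<^sup>2\<close> tends to 0, so
  invertibility of \<open>H\<^bsub><i,<i\<^esub>\<close> expresses the leading part of \<open>x\<^bsub><i\<^esub>\<close> through \<open>u\<^sub>i(0)\<close> and forces
  \<open>u\<^bsub><i\<^esub>(0) = 0\<close>. Substituting into the remaining rows gives \<open>\<alpha> = 2 \<nu>\<^sub>i\<close>,
  \<open>u\<^sub>l(0) = 0\<close> for \<open>l \<noteq> i\<close> and \<open>S\<^sub>i u\<^sub>i(0) = c u\<^sub>i(0)\<close>. The same argument shows that an
  eigenvector whose eigenvalue has valuation greater than \<open>2 \<nu>\<^sub>j\<close> is, at \<open>\<epsilon> = 0\<close>, supported on the blocks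
  after \<open>j\<close>. Hence the orthonormal basis \<open>u\<^sub>k(0)\<close> diagonalizes the block-diagonal matrix on the
  right-hand side, with eigenvalues the leading terms, and no multiplicities need to be counted.
\<close>

section \<open>Asymptotics of a single eigenpair\<close>

text \<open>No bound on \<open>y\<close> is assumed. Applying \<open>B\<close> turns the system into
  \<open>y = g - G y\<close> with \<open>G\<close> tending to 0. Once \<open>G\<close> is small in
  total, its contribution is absorbed and \<open>y\<close> is bounded in terms of \<open>g\<close>;
  then \<open>G y\<close> tends to 0 as well.\<close>

lemma perturbed_system_tendsto:
  fixes A B :: "nat \<Rightarrow> nat \<Rightarrow> real" and E :: "nat \<Rightarrow> nat \<Rightarrow> 'a \<Rightarrow> real"
  assumes inv: "\<And>r t. r < m \<Longrightarrow> t < m \<Longrightarrow> (\<Sum>q<m. B r q * A q t) = (if r = t then 1 else 0)"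
    and E: "\<And>q t. q < m \<Longrightarrow> t < m \<Longrightarrow> (E q t \<longlongrightarrow> 0) F"
    and f: "\<And>q. q < m \<Longrightarrow> (f q \<longlongrightarrow> f0 q) F"
    and eq: "\<forall>\<^sub>F x in F. \<forall>q<m. (\<Sum>t<m. (A q t + E q t x) * y t x) = f q x"
    and r: "r < m"
  shows "(y r \<longlongrightarrow> (\<Sum>q<m. B r q * f0 q)) F"
proof -
  define g where "g r x = (\<Sum>q<m. B r q * f q x)" for r x
  define G where "G r t x = (\<Sum>q<m. B r q * E q t x)" for r t x
  define s where "s x = (\<Sum>t<m. \<bar>y t x\<bar>)" for x
  have g_lim: "(g r \<longlongrightarrow> (\<Sum>q<m. B r q * f0 q)) F" for r
    unfolding g_def by (intro tendsto_intros f) auto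
  have G_lim: "(G r t \<longlongrightarrow> 0) F" if "t < m" for r t
  proof -
    have "(G r t \<longlongrightarrow> (\<Sum>q<m. B r q * 0)) F"
      unfolding G_def by (intro tendsto_intros E) (use that in auto)
    then show ?thesis by simp
  qed
  have y_eq: "\<forall>\<^sub>F x in F. \<forall>r<m. y r x = g r x - (\<Sum>t<m. G r t x * y t x)"
    using eq
  proof eventually_elim
    case (elim x)
    show ?case
    proof (intro allI impI)
      fix r assume r: "r < m"
      have "g r x = (\<Sum>q<m. \<Sum>t<m. B r q * A q t * y t x + B r q * E q t x * y t x)"
        unfolding g_def using elim
        by (intro sum.cong refl) (simp add: sum_distrib_left algebra_simps flip: elim[rule_format])
      also have "\<dots> = (\<Sum>t<m. \<Sum>q<m. B r q * A q t * y t x + B r q * E q t x * y t x)"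
        by (rule sum.swap)
      also have "\<dots> = (\<Sum>t<m. (\<Sum>q<m. B r q * A q t) * y t x + G r t x * y t x)"
        unfolding G_def by (simp add: sum.distrib sum_distrib_right)
      also have "\<dots> = (\<Sum>t<m. (if r = t then y t x else 0) + G r t x * y t x)"
        using r by (intro sum.cong refl) (simp add: inv)
      also have "\<dots> = y r x + (\<Sum>t<m. G r t x * y t x)"
        using r by (simp add: sum.distrib)
      finally show "y r x = g r x - (\<Sum>t<m. G r t x * y t x)" by simp
    qed
  qed
  define T where "T x = (\<Sum>r<m. \<Sum>t<m. \<bar>G r t x\<bar>)" for x
  have "(T \<longlongrightarrow> (\<Sum>r<m. \<Sum>t<m. \<bar>0\<bar>)) F"
    unfolding T_def by (intro tendsto_intros G_lim) auto
  then have T_lim: "(T \<longlongrightarrow> 0) F" by simp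
  \<comment> \<open>The threshold 1/2 lets \<open>T x * s x\<close> be absorbed into
    \<open>s x\<close>, which leaves \<open>s x\<close> bounded by twice the absolute sum of
    \<open>g\<close>.\<close>
  have T_small: "\<forall>\<^sub>F x in F. T x < 1/2"
    by (rule order_tendstoD(2)[OF T_lim]) simp
  have Gy: "(\<Sum>t<m. \<bar>G r t x * y t x\<bar>) \<le> (\<Sum>t<m. \<bar>G r t x\<bar>) * s x" for r x
    unfolding sum_distrib_right abs_mult
    by (intro sum_mono mult_left_mono) (auto simp: s_def intro: member_le_sum)
  \<comment> \<open>The factor in parentheses is the bound on \<open>s\<close> gained by absorption,
    so \<open>h\<close> dominates \<open>G y\<close> and inherits the limit 0 from
    \<open>T\<close>.\<close>
  define h where "h x = T x * (2 * (\<Sum>r<m. \<bar>g r x\<bar>))" for x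
  have bound: "\<forall>\<^sub>F x in F. \<bar>y r x - g r x\<bar> \<le> h x"
    using y_eq T_small
  proof eventually_elim
    case (elim x)
    have T0: "T x \<ge> 0" "s x \<ge> 0" unfolding T_def s_def by (auto intro!: sum_nonneg)
    have "s x \<le> (\<Sum>r<m. \<bar>g r x\<bar> + (\<Sum>t<m. \<bar>G r t x\<bar>) * s x)"
      unfolding s_def[of x]
    proof (intro sum_mono)
      fix r assume "r \<in> {..<m}"
      then have "\<bar>y r x\<bar> \<le> \<bar>g r x\<bar> + \<bar>\<Sum>t<m. G r t x * y t x\<bar>" using elim(1) by auto
      also have "\<bar>\<Sum>t<m. G r t x * y t x\<bar> \<le> (\<Sum>t<m. \<bar>G r t x\<bar>) * s x"
        by (rule order_trans[OF sum_abs Gy])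
      finally show "\<bar>y r x\<bar> \<le> \<bar>g r x\<bar> + (\<Sum>t<m. \<bar>G r t x\<bar>) * (\<Sum>t<m. \<bar>y t x\<bar>)"
        unfolding s_def by simp
    qed
    also have "\<dots> = (\<Sum>r<m. \<bar>g r x\<bar>) + T x * s x"
      unfolding T_def by (simp add: sum.distrib sum_distrib_right)
    also have "\<dots> \<le> (\<Sum>r<m. \<bar>g r x\<bar>) + 1/2 * s x"
      using elim(2) T0 by (intro add_left_mono mult_right_mono) auto
    finally have s: "s x \<le> 2 * (\<Sum>r<m. \<bar>g r x\<bar>)" by simp
    have "\<bar>y r x - g r x\<bar> \<le> (\<Sum>t<m. \<bar>G r t x * y t x\<bar>)"
      using elim(1) r by (auto intro: sum_abs)
    also have "\<dots> \<le> (\<Sum>t<m. \<bar>G r t x\<bar>) * s x" by (rule Gy)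
    also have "\<dots> \<le> T x * s x"
      unfolding T_def using T0 r
      by (intro mult_right_mono member_le_sum[of r _ "\<lambda>r. \<Sum>t<m. \<bar>G r t x\<bar>"] sum_nonneg) auto
    also have "\<dots> \<le> h x" unfolding h_def using s T0 by (intro mult_left_mono) auto
    finally show ?case .
  qed
  have "(h \<longlongrightarrow> 0 * (2 * (\<Sum>r<m. \<bar>\<Sum>q<m. B r q * f0 q\<bar>))) F"
    unfolding h_def by (intro tendsto_intros T_lim g_lim)
  then have "(h \<longlongrightarrow> 0) F" by simp
  then have "((\<lambda>x. y r x - g r x) \<longlongrightarrow> 0) F"
    by (rule tendsto_0_le[where K = 1, OF _ eventually_mono[OF bound]]) auto
  from tendsto_add[OF this g_lim[of r]] show ?thesis by simp
qed

text \<open>Both values matter below: exponent 0 is the critical scale, at which a row survives in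
  the limit, and a positive exponent makes it disappear.\<close>

lemma powr_tendsto_at_right_zero:
  assumes "(0::real) \<le> a"
  shows "((\<lambda>\<epsilon>. \<epsilon> powr a) \<longlongrightarrow> (if a = 0 then 1 else 0)) (at_right 0)"
proof (cases "a = 0")
  case True
  have "\<forall>\<^sub>F \<epsilon> in at_right 0. \<epsilon> powr a = (1::real)"
    by (rule eventually_at_rightI[of 0 1]) (use True in auto)
  then show ?thesis using True by (simp add: tendsto_eventually)
next
  case False
  then have "((\<lambda>\<epsilon>. \<epsilon> powr a) \<longlongrightarrow> 0) (at_right (0::real))"
    by (intro tendsto_zero_powrI[where b = a]) (use assms in \<open>auto simp: eventually_at_filter intro!: tendsto_intros\<close>)
  then show ?thesis using False by simp
qed

section \<open>Rescaling and block elimination for one eigenpair\<close>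

text \<open>With \<open>B\<close> the inverse of the leading \<open>m\<close> by \<open>m\<close>
  part of \<open>h\<close>, this is an entry of the Schur complement of that part. It covers all
  remaining rows and columns, of which a single block is cut out later.\<close>

definition schur_entry :: "nat \<Rightarrow> (nat \<Rightarrow> nat \<Rightarrow> real) \<Rightarrow> (nat \<Rightarrow> nat \<Rightarrow> real) \<Rightarrow> nat \<Rightarrow> nat \<Rightarrow> real" where
  "schur_entry m B h r c = h r c - (\<Sum>q<m. \<Sum>q'<m. h r q * B q q' * h q' c)"

text \<open>One eigenpair seen at scale \<open>s\<close>: the indices below \<open>m\<close> have
  exponents below \<open>s\<close>, and the eigenvalue is negligible against their squared weights.
  The scale is a parameter because it is taken once as the exponent matching the eigenvalue and once
  as a level above \<open>\<nu> j\<close>.\<close>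

locale graded_eigenpair =
  fixes n m :: nat and s :: real and \<mu> :: "nat \<Rightarrow> real"
    and h B :: "nat \<Rightarrow> nat \<Rightarrow> real" and R :: "nat \<Rightarrow> nat \<Rightarrow> real \<Rightarrow> real"
    and l :: "real \<Rightarrow> real" and v :: "nat \<Rightarrow> real \<Rightarrow> real" and v0 :: "nat \<Rightarrow> real"
  assumes m_le: "m \<le> n"
    and inv: "\<And>r t. r < m \<Longrightarrow> t < m \<Longrightarrow> (\<Sum>q<m. B r q * h q t) = (if r = t then 1 else 0)"
    and low: "\<And>r. r < m \<Longrightarrow> \<mu> r < s"
    and high: "\<And>r. m \<le> r \<Longrightarrow> r < n \<Longrightarrow> s \<le> \<mu> r"
    and R: "\<And>r c. r < n \<Longrightarrow> c < n \<Longrightarrow> (R r c \<longlongrightarrow> 0) (at_right 0)"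
    and v: "\<And>r. r < n \<Longrightarrow> (v r \<longlongrightarrow> v0 r) (at_right 0)"
    and l_small: "\<And>r. r < m \<Longrightarrow> ((\<lambda>\<epsilon>. l \<epsilon> * \<epsilon> powr (- 2 * \<mu> r)) \<longlongrightarrow> 0) (at_right 0)"
    and eigen: "\<forall>\<^sub>F \<epsilon> in at_right 0. \<forall>r<n.
      (\<Sum>c<n. \<epsilon> powr \<mu> r * (h r c + R r c \<epsilon>) * \<epsilon> powr \<mu> c * v c \<epsilon>) = l \<epsilon> * v r \<epsilon>"
begin

text \<open>\<open>y\<close> is \<open>\<epsilon>\<^sup>-\<^sup>s \<Delta> u\<close>, and \<open>w\<close> turns out to be its limit.\<close>

definition y :: "nat \<Rightarrow> real \<Rightarrow> real" where "y r \<epsilon> = \<epsilon> powr (\<mu> r - s) * v r \<epsilon>"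

text \<open>The limit of \<open>y\<close> in the rows from \<open>m\<close> on, where
  \<open>\<epsilon> powr (\<mu> r - s)\<close> is 1 at exponent \<open>s\<close> and tends to 0
  beyond it.\<close>

definition z :: "nat \<Rightarrow> real" where "z r = (if \<mu> r = s then v0 r else 0)"

definition w :: "nat \<Rightarrow> real" where
  "w r = (if r < m then - (\<Sum>q<m. B r q * (\<Sum>t\<in>{m..<n}. h q t * z t)) else z r)"

text \<open>Row \<open>r\<close> is divided by \<open>\<epsilon> powr (s + \<mu> r)\<close>: the row
  weight cancels, and the column weight together with \<open>\<epsilon> powr (- s)\<close> is
  contained in \<open>y\<close>.\<close>

lemma eigen_y:
  "\<forall>\<^sub>F \<epsilon> in at_right 0. \<forall>r<n.
     (\<Sum>c<n. (h r c + R r c \<epsilon>) * y c \<epsilon>) = l \<epsilon> * \<epsilon> powr (- s - \<mu> r) * v r \<epsilon>"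
  using eigen eventually_at_right_less[of 0]
proof eventually_elim
  case (elim \<epsilon>)
  show ?case
  proof (intro allI impI)
    fix r assume r: "r < n"
    have "(\<Sum>c<n. (h r c + R r c \<epsilon>) * y c \<epsilon>) =
      \<epsilon> powr (- s - \<mu> r) * (\<Sum>c<n. \<epsilon> powr \<mu> r * (h r c + R r c \<epsilon>) * \<epsilon> powr \<mu> c * v c \<epsilon>)"
      unfolding sum_distrib_left
    proof (intro sum.cong refl)
      fix c
      have "\<epsilon> powr (\<mu> c - s) = \<epsilon> powr (- s - \<mu> r) * \<epsilon> powr \<mu> r * \<epsilon> powr \<mu> c"
        using elim(2) by (simp flip: powr_add)
      then show "(h r c + R r c \<epsilon>) * y c \<epsilon> =
        \<epsilon> powr (- s - \<mu> r) * (\<epsilon> powr \<mu> r * (h r c + R r c \<epsilon>) * \<epsilon> powr \<mu> c * v c \<epsilon>)"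
        unfolding y_def by simp
    qed
    also have "\<dots> = l \<epsilon> * \<epsilon> powr (- s - \<mu> r) * v r \<epsilon>"
      using elim(1) r by simp
    finally show "(\<Sum>c<n. (h r c + R r c \<epsilon>) * y c \<epsilon>) = l \<epsilon> * \<epsilon> powr (- s - \<mu> r) * v r \<epsilon>" .
  qed
qed

lemma y_high:
  assumes "m \<le> r" "r < n"
  shows "(y r \<longlongrightarrow> z r) (at_right 0)"
proof -
  have "((\<lambda>\<epsilon>. \<epsilon> powr (\<mu> r - s) * v r \<epsilon>) \<longlongrightarrow> (if \<mu> r - s = 0 then 1 else 0) * v0 r) (at_right 0)"
    by (intro tendsto_mult powr_tendsto_at_right_zero v) (use assms high in auto)
  then show ?thesis unfolding y_def z_def by (auto split: if_splits)
qed

text \<open>In the rows below \<open>m\<close> the factor in \<open>y\<close> blows up, so the limit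
  cannot be read off termwise. The rows from \<open>m\<close> on, whose limits are known, go to the
  right-hand side \<open>f\<close>; the first \<open>m\<close> equations then form a perturbed
  system with invertible matrix \<open>h\<close>.\<close>

lemma y_tendsto:
  assumes "r < n"
  shows "(y r \<longlongrightarrow> w r) (at_right 0)"
proof (cases "r < m")
  case True
  \<comment> \<open>The eigenvalue term is counted as a diagonal perturbation of the matrix; by
    \<open>l_small\<close> it vanishes in the limit.\<close>
  define E where "E q t \<epsilon> = R q t \<epsilon> - (if q = t then l \<epsilon> * \<epsilon> powr (- 2 * \<mu> q) else 0)" for q t \<epsilon>
  define f where "f q \<epsilon> = - (\<Sum>t\<in>{m..<n}. (h q t + R q t \<epsilon>) * y t \<epsilon>)" for q \<epsilon>
  have "(y r \<longlongrightarrow> (\<Sum>q<m. B r q * (- (\<Sum>t\<in>{m..<n}. (h q t + 0) * z t)))) (at_right 0)"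
  proof (rule perturbed_system_tendsto[where A = h and E = E and f = f])
    show "(E q t \<longlongrightarrow> 0) (at_right 0)" if "q < m" "t < m" for q t
      unfolding E_def
      by (cases "q = t") (use tendsto_diff[OF R[of q t] l_small[of q]] R that m_le in auto)
    show "(f q \<longlongrightarrow> - (\<Sum>t\<in>{m..<n}. (h q t + 0) * z t)) (at_right 0)" if "q < m" for q
      unfolding f_def by (intro tendsto_intros R y_high) (use that m_le in auto)
    show "\<forall>\<^sub>F \<epsilon> in at_right 0. \<forall>q<m. (\<Sum>t<m. (h q t + E q t \<epsilon>) * y t \<epsilon>) = f q \<epsilon>"
      using eigen_y eventually_at_right_less[of 0]
    proof eventually_elim
      case (elim \<epsilon>)
      show ?case
      proof (intro allI impI)
        fix q assume q: "q < m"
        have split: "{..<n} = {..<m} \<union> {m..<n}" using m_le by auto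
        have "(\<Sum>t<m. (h q t + E q t \<epsilon>) * y t \<epsilon>) =
          (\<Sum>t<m. (h q t + R q t \<epsilon>) * y t \<epsilon> - (if q = t then l \<epsilon> * \<epsilon> powr (- 2 * \<mu> q) * y q \<epsilon> else 0))"
          unfolding E_def by (intro sum.cong) (auto simp: algebra_simps)
        also have "\<dots> = (\<Sum>t<m. (h q t + R q t \<epsilon>) * y t \<epsilon>) - l \<epsilon> * \<epsilon> powr (- 2 * \<mu> q) * y q \<epsilon>"
          using q by (simp add: sum_subtractf)
        \<comment> \<open>Expressing \<open>v q\<close> through \<open>y q\<close> identifies the
          diagonal term of \<open>E\<close> with the right-hand side of
          \<open>eigen_y\<close>.\<close>
        also have "l \<epsilon> * \<epsilon> powr (- 2 * \<mu> q) * y q \<epsilon> = l \<epsilon> * \<epsilon> powr (- s - \<mu> q) * v q \<epsilon>"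
        proof -
          have "\<epsilon> powr (- 2 * \<mu> q) * \<epsilon> powr (\<mu> q - s) = \<epsilon> powr (- s - \<mu> q)"
            using elim(2) by (simp add: algebra_simps flip: powr_add)
          then show ?thesis unfolding y_def by (metis mult.assoc)
        qed
        also have "\<dots> = (\<Sum>c<n. (h q c + R q c \<epsilon>) * y c \<epsilon>)"
          using elim(1) q m_le by simp
        also have "\<dots> = (\<Sum>t<m. (h q t + R q t \<epsilon>) * y t \<epsilon>) - f q \<epsilon>"
          unfolding f_def split by (subst sum.union_disjoint) auto
        finally show "(\<Sum>t<m. (h q t + E q t \<epsilon>) * y t \<epsilon>) = f q \<epsilon>" by simp
      qed
    qed
  qed (use True inv in auto)
  then show ?thesis using True by (simp add: w_def sum_negf)
next
  case False
  then show ?thesis using y_high[of r] assms by (simp add: w_def)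
qed

text \<open>Here \<open>v\<close> is the convergent \<open>y\<close> times a positive power of
  \<open>\<epsilon>\<close>.\<close>

lemma v0_low:
  assumes r: "r < m"
  shows "v0 r = 0"
proof -
  have "((\<lambda>\<epsilon>. \<epsilon> powr (s - \<mu> r) * y r \<epsilon>) \<longlongrightarrow> (if s - \<mu> r = 0 then 1 else 0) * w r) (at_right 0)"
    by (intro tendsto_mult powr_tendsto_at_right_zero y_tendsto) (use low[OF r] r m_le in auto)
  then have "((\<lambda>\<epsilon>. \<epsilon> powr (s - \<mu> r) * y r \<epsilon>) \<longlongrightarrow> 0) (at_right 0)"
    using low[OF r] by simp
  moreover have "\<forall>\<^sub>F \<epsilon> in at_right 0. \<epsilon> powr (s - \<mu> r) * y r \<epsilon> = v r \<epsilon>"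
    using eventually_at_right_less[of 0]
  proof eventually_elim
    case (elim \<epsilon>)
    have "\<epsilon> powr (s - \<mu> r) * \<epsilon> powr (\<mu> r - s) = 1" using elim by (simp flip: powr_add)
    then show ?case unfolding y_def by (metis mult.assoc mult_1)
  qed
  ultimately have "(v r \<longlongrightarrow> 0) (at_right 0)" by (rule Lim_transform_eventually)
  then show ?thesis using v[of r] r m_le tendsto_unique[OF trivial_limit_at_right_real] by auto
qed

text \<open>Block elimination: below \<open>m\<close>, \<open>w\<close> is \<open>- B\<close>
  applied to the coupling with \<open>z\<close>, so substitution leaves the Schur complement acting
  on \<open>z\<close> alone.\<close>

lemma sum_h_w:
  "(\<Sum>c<n. h r c * w c) = (\<Sum>t\<in>{m..<n}. schur_entry m B h r t * z t)"
proof -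
  have split: "{..<n} = {..<m} \<union> {m..<n}" using m_le by auto
  have "(\<Sum>c<m. h r c * w c) = - (\<Sum>q<m. \<Sum>q'<m. \<Sum>t\<in>{m..<n}. h r q * B q q' * h q' t * z t)"
    by (simp add: w_def sum_negf sum_distrib_left mult.assoc)
  also have "\<dots> = - (\<Sum>t\<in>{m..<n}. \<Sum>q<m. \<Sum>q'<m. h r q * B q q' * h q' t * z t)"
    by (simp add: sum.swap[of _ "{m..<n}"])
  finally have low_part: "(\<Sum>c<m. h r c * w c) =
      - (\<Sum>t\<in>{m..<n}. \<Sum>q<m. \<Sum>q'<m. h r q * B q q' * h q' t * z t)" .
  have "(\<Sum>c<n. h r c * w c) = (\<Sum>c<m. h r c * w c) + (\<Sum>t\<in>{m..<n}. h r t * z t)"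
    unfolding split by (subst sum.union_disjoint) (auto simp: w_def)
  also have "\<dots> = (\<Sum>t\<in>{m..<n}. schur_entry m B h r t * z t)"
    unfolding low_part schur_entry_def
    by (simp add: algebra_simps sum_subtractf sum_distrib_left sum_distrib_right)
  finally show ?thesis .
qed

lemma scaled_eigenvalue_tendsto:
  assumes "r < n"
  shows "((\<lambda>\<epsilon>. l \<epsilon> * \<epsilon> powr (- s - \<mu> r) * v r \<epsilon>) \<longlongrightarrow>
      (\<Sum>t\<in>{m..<n}. schur_entry m B h r t * z t)) (at_right 0)"
proof (rule Lim_transform_eventually)
  show "((\<lambda>\<epsilon>. \<Sum>c<n. (h r c + R r c \<epsilon>) * y c \<epsilon>) \<longlongrightarrow> (\<Sum>t\<in>{m..<n}. schur_entry m B h r t * z t)) (at_right 0)"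
  proof -
    have "((\<lambda>\<epsilon>. \<Sum>c<n. (h r c + R r c \<epsilon>) * y c \<epsilon>) \<longlongrightarrow> (\<Sum>c<n. (h r c + 0) * w c)) (at_right 0)"
      by (intro tendsto_intros R y_tendsto) (use assms in auto)
    then show ?thesis by (simp add: sum_h_w)
  qed
  show "\<forall>\<^sub>F \<epsilon> in at_right 0. (\<Sum>c<n. (h r c + R r c \<epsilon>) * y c \<epsilon>) = l \<epsilon> * \<epsilon> powr (- s - \<mu> r) * v r \<epsilon>"
    using eigen_y by eventually_elim (use assms in auto)
qed

text \<open>The limit in \<open>scaled_eigenvalue_tendsto\<close> is multiplied by
  \<open>\<epsilon> powr (s + \<mu> r - a)\<close>, which tends to 1 or 0, and compared with that of
  \<open>k * v r\<close>. Equality of exponents gives the eigenvector equation of the Schur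
  complement; the strict case forces \<open>v0 r = 0\<close> when \<open>c\<close> is
  nonzero.\<close>

lemma eigenvalue_high:
  assumes l: "\<forall>\<^sub>F \<epsilon> in at_right 0. l \<epsilon> = \<epsilon> powr a * k \<epsilon>" and k: "(k \<longlongrightarrow> c) (at_right 0)"
    and r: "r < n" and a: "a \<le> s + \<mu> r"
  shows "c * v0 r = (if a = s + \<mu> r then \<Sum>t\<in>{m..<n}. schur_entry m B h r t * z t else 0)"
proof -
  have "((\<lambda>\<epsilon>. \<epsilon> powr (s + \<mu> r - a) * (l \<epsilon> * \<epsilon> powr (- s - \<mu> r) * v r \<epsilon>)) \<longlongrightarrow>
      (if s + \<mu> r - a = 0 then 1 else 0) * (\<Sum>t\<in>{m..<n}. schur_entry m B h r t * z t)) (at_right 0)"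
    by (intro tendsto_mult powr_tendsto_at_right_zero scaled_eigenvalue_tendsto) (use r a in auto)
  moreover have "\<forall>\<^sub>F \<epsilon> in at_right 0.
      \<epsilon> powr (s + \<mu> r - a) * (l \<epsilon> * \<epsilon> powr (- s - \<mu> r) * v r \<epsilon>) = k \<epsilon> * v r \<epsilon>"
    using l eventually_at_right_less[of 0]
  proof eventually_elim
    case (elim \<epsilon>)
    have "\<epsilon> powr (s + \<mu> r - a) * (\<epsilon> powr a * \<epsilon> powr (- s - \<mu> r)) = 1"
      using elim(2) by (simp flip: powr_add)
    then show ?case using elim(1)
      by (metis (no_types, opaque_lifting) mult.assoc mult.commute mult_1)
  qed
  ultimately have "((\<lambda>\<epsilon>. k \<epsilon> * v r \<epsilon>) \<longlongrightarrow>
      (if s + \<mu> r - a = 0 then 1 else 0) * (\<Sum>t\<in>{m..<n}. schur_entry m B h r t * z t)) (at_right 0)"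
    by (rule Lim_transform_eventually)
  from tendsto_unique[OF trivial_limit_at_right_real this tendsto_mult[OF k v[OF r]]]
  show ?thesis by auto
qed

end

section \<open>Leading forms\<close>

lemma analytic_at_zero_isCont:
  assumes "analytic_at_zero f"
  shows "isCont f 0"
proof -
  obtain a r where "r > 0" and sums: "\<And>x. \<bar>x\<bar> < r \<Longrightarrow> (\<lambda>k. a k * x ^ k) sums f x"
    using assms unfolding analytic_at_zero_def by blast
  then have "(f \<longlongrightarrow> a 0) (at 0)"
    by (intro powser_limit_0[of r a f]) auto
  moreover have "f 0 = a 0"
    using sums[of 0] \<open>r > 0\<close> powser_sums_zero[of a] sums_unique2 by fastforce
  ultimately show ?thesis by (simp add: isCont_def)
qed

lemma leading_form_exists:
  assumes "analytic_at_zero f" "\<not> vanishes_near_zero f"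
  shows "\<exists>\<alpha> c. leading_form f \<alpha> c"
proof -
  obtain a r where r: "r > 0" and sums: "\<And>x. \<bar>x\<bar> < r \<Longrightarrow> (\<lambda>k. a k * x ^ k) sums f x"
    using assms unfolding analytic_at_zero_def by blast
  have near: "\<forall>\<^sub>F x in nhds 0. \<bar>x\<bar> < r"
    using r by (auto simp: eventually_nhds_metric)
  have "\<exists>k. a k \<noteq> 0"
  proof (rule ccontr)
    assume "\<not> (\<exists>k. a k \<noteq> 0)"
    then have "f x = 0" if "\<bar>x\<bar> < r" for x
      using sums[OF that] sums_unique2[OF sums_zero] by auto
    then have "vanishes_near_zero f"
      unfolding vanishes_near_zero_def using near by (auto elim: eventually_mono)
    with assms(2) show False ..
  qed
  define m where "m = (LEAST k. a k \<noteq> 0)"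
  have am: "a m \<noteq> 0" and below: "\<And>k. k < m \<Longrightarrow> a k = 0"
    using LeastI_ex[OF \<open>\<exists>k. a k \<noteq> 0\<close>] not_less_Least[of _ "\<lambda>k. a k \<noteq> 0"]
    unfolding m_def by blast+
  \<comment> \<open>Near 0, \<open>q\<close> is the sum of the series with coefficients
    \<open>a (k + Suc m)\<close>. It has a limit there, so \<open>x * q x\<close> is the required
    \<open>O(\<epsilon>)\<close> remainder.\<close>
  define q where "q x = (f x / x ^ m - a m) / x" for x
  have "(\<lambda>k. a (k + Suc m) * x ^ k) sums q x" if x: "x \<noteq> 0" "norm x < r" for x
  proof -
    have "(\<lambda>k. a (k + Suc m) * x ^ (k + Suc m)) sums (f x - (\<Sum>k<Suc m. a k * x ^ k))"
      using sums[of x] x sums_iff_shift[of "\<lambda>k. a k * x ^ k" "Suc m"] by simp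
    moreover have "(\<Sum>k<Suc m. a k * x ^ k) = a m * x ^ m"
      using below by simp
    ultimately have "(\<lambda>k. a (k + Suc m) * x ^ (k + Suc m)) sums (f x - a m * x ^ m)"
      by simp
    from sums_divide[OF this, of "x ^ Suc m"]
    have "(\<lambda>k. a (k + Suc m) * x ^ k) sums ((f x - a m * x ^ m) / x ^ Suc m)"
      using x by (simp add: power_add)
    also have "(f x - a m * x ^ m) / x ^ Suc m = q x"
      unfolding q_def using x by (simp add: field_simps)
    finally show ?thesis .
  qed
  then have "(q \<longlongrightarrow> a (0 + Suc m)) (at 0)"
    by (rule powser_limit_0_strong[OF r])
  then have "q \<in> O[at 0](\<lambda>_. 1)"
    by (intro bigoI_tendsto[where c = "a (0 + Suc m)"]) auto
  then have "(\<lambda>x. x * q x) \<in> O[at 0](\<lambda>x. x * 1)"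
    by (intro landau_o.big.mult) auto
  moreover have "\<forall>\<^sub>F x in at 0. f x = x ^ m * (a m + x * q x)"
    by (auto simp: eventually_at_filter q_def)
  ultimately show ?thesis
    unfolding leading_form_def using am by (intro exI[of _ m] exI[of _ "a m"]) auto
qed

lemma leading_formE:
  assumes "leading_form f \<alpha> c"
  obtains k where "c \<noteq> 0" "(k \<longlongrightarrow> c) (at 0)" "\<forall>\<^sub>F \<epsilon> in at 0. f \<epsilon> = \<epsilon> ^ \<alpha> * k \<epsilon>"
proof -
  obtain g where g: "c \<noteq> 0" "g \<in> O[at 0](\<lambda>\<epsilon>. \<epsilon>)" "\<forall>\<^sub>F \<epsilon> in at 0. f \<epsilon> = \<epsilon> ^ \<alpha> * (c + g \<epsilon>)"
    using assms unfolding leading_form_def by blast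
  obtain C where C: "C > 0" "\<forall>\<^sub>F x in at 0. norm (g x) \<le> C * norm x"
    using g(2) by (auto elim: landau_o.bigE)
  have "(g \<longlongrightarrow> 0) (at 0)"
    by (rule tendsto_0_le[OF tendsto_ident_at, where K = C])
       (use C in \<open>simp add: mult.commute\<close>)
  then have "((\<lambda>\<epsilon>. c + g \<epsilon>) \<longlongrightarrow> c) (at 0)"
    using tendsto_add[OF tendsto_const[of c]] by fastforce
  with g that show thesis by blast
qed

lemma leading_form_not_vanishing:
  assumes "leading_form f \<alpha> c"
  shows "\<not> vanishes_near_zero f"
proof
  assume "vanishes_near_zero f"
  then have zero: "\<forall>\<^sub>F \<epsilon> in at 0. f \<epsilon> = 0"
    unfolding vanishes_near_zero_def by (auto simp: eventually_at_filter elim: eventually_mono)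
  obtain k where k: "c \<noteq> 0" "(k \<longlongrightarrow> c) (at 0)" "\<forall>\<^sub>F \<epsilon> in at 0. f \<epsilon> = \<epsilon> ^ \<alpha> * k \<epsilon>"
    using leading_formE[OF assms] .
  have "\<forall>\<^sub>F \<epsilon> in at 0. k \<epsilon> = 0"
    using zero k(3) eventually_neq_at_within[of 0 0 UNIV]
    by eventually_elim auto
  then have "(k \<longlongrightarrow> 0) (at 0)" by (rule tendsto_eventually)
  with k(1,2) show False using tendsto_unique[of "at (0::real)"] by auto
qed

text \<open>With the exponents ordered, cancelling the smaller power in the two representations
  relates \<open>k\<close> and \<open>k'\<close>, and their limits at 0 decide.\<close>

lemma leading_form_unique:
  assumes "leading_form f \<alpha> c" "leading_form f \<beta> d"
  shows "\<alpha> = \<beta> \<and> c = d"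
  using assms
proof (induction \<alpha> \<beta> arbitrary: c d rule: linorder_wlog)
  case (le \<alpha> \<beta>)
  obtain k where k: "c \<noteq> 0" "(k \<longlongrightarrow> c) (at 0)" "\<forall>\<^sub>F \<epsilon> in at 0. f \<epsilon> = \<epsilon> ^ \<alpha> * k \<epsilon>"
    using leading_formE[OF le(2)] .
  obtain k' where k': "d \<noteq> 0" "(k' \<longlongrightarrow> d) (at 0)" "\<forall>\<^sub>F \<epsilon> in at 0. f \<epsilon> = \<epsilon> ^ \<beta> * k' \<epsilon>"
    using leading_formE[OF le(3)] .
  have "\<forall>\<^sub>F \<epsilon> in at 0. k \<epsilon> = \<epsilon> ^ (\<beta> - \<alpha>) * k' \<epsilon>"
    using k(3) k'(3) eventually_neq_at_within[of 0 0 UNIV]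
  proof eventually_elim
    case (elim \<epsilon>)
    have "\<epsilon> ^ \<beta> = \<epsilon> ^ \<alpha> * \<epsilon> ^ (\<beta> - \<alpha>)" using le(1) by (simp flip: power_add)
    with elim show ?case by simp
  qed
  \<comment> \<open>Because \<open>0 ^ 0 = 1\<close>, this limit is also right for equal exponents
    and then gives \<open>c = d\<close>; for different exponents it is 0, against
    \<open>c \<noteq> 0\<close>.\<close>
  moreover have "((\<lambda>\<epsilon>. \<epsilon> ^ (\<beta> - \<alpha>) * k' \<epsilon>) \<longlongrightarrow> 0 ^ (\<beta> - \<alpha>) * d) (at 0)"
    by (intro tendsto_intros k')
  ultimately have "(k \<longlongrightarrow> 0 ^ (\<beta> - \<alpha>) * d) (at 0)"
    by (subst tendsto_cong)
  then have "c = 0 ^ (\<beta> - \<alpha>) * d" using k(2) tendsto_unique[of "at (0::real)"] by auto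
  then show ?case using le(1) k(1) by (cases "\<alpha> = \<beta>") auto
next
  case (sym \<alpha> \<beta>)
  then show ?case by blast
qed

lemma leading_form_valuation:
  assumes "leading_form f \<alpha> c"
  shows "valuation f = enat \<alpha>" "leading_term f \<epsilon> = c * \<epsilon> ^ \<alpha>"
proof -
  have "(THE \<alpha>. \<exists>c. leading_form f \<alpha> c) = \<alpha>" "(THE c. \<exists>\<alpha>. leading_form f \<alpha> c) = c"
    using assms leading_form_unique by blast+
  then show "valuation f = enat \<alpha>" "leading_term f \<epsilon> = c * \<epsilon> ^ \<alpha>"
    using leading_form_not_vanishing[OF assms] by (auto simp: valuation_def leading_term_def)
qed

text \<open>Supplies \<open>l_small\<close>: the product is a positive power of
  \<open>\<epsilon>\<close> times a convergent factor.\<close>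

lemma leading_form_scaled_tendsto_0:
  assumes "leading_form f \<alpha> c" and "2 * a < real \<alpha>"
  shows "((\<lambda>\<epsilon>. f \<epsilon> * \<epsilon> powr (- 2 * a)) \<longlongrightarrow> 0) (at_right 0)"
proof -
  obtain k where k: "(k \<longlongrightarrow> c) (at 0)" "\<forall>\<^sub>F \<epsilon> in at 0. f \<epsilon> = \<epsilon> ^ \<alpha> * k \<epsilon>"
    using leading_formE[OF assms(1)] .
  have "((\<lambda>\<epsilon>. \<epsilon> powr (\<alpha> - 2 * a) * k \<epsilon>) \<longlongrightarrow> (if real \<alpha> - 2 * a = 0 then 1 else 0) * c) (at_right 0)"
    using assms(2) tendsto_within_subset[OF k(1), of "{0<..}"]
    by (intro tendsto_mult powr_tendsto_at_right_zero) auto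
  then have "((\<lambda>\<epsilon>. \<epsilon> powr (\<alpha> - 2 * a) * k \<epsilon>) \<longlongrightarrow> 0) (at_right 0)"
    using assms(2) by simp
  moreover have "\<forall>\<^sub>F \<epsilon> in at_right 0. \<epsilon> powr (\<alpha> - 2 * a) * k \<epsilon> = f \<epsilon> * \<epsilon> powr (- 2 * a)"
    using filter_leD[OF at_le[of "{0<..}" UNIV] k(2)[simplified]] eventually_at_right_less[of 0]
    by (auto elim!: eventually_elim2 simp: powr_realpow[symmetric] powr_add[symmetric])
  ultimately show ?thesis by (rule Lim_transform_eventually)
qed

section \<open>Block matrices and Schur complements\<close>

lemma offset_Suc [simp]: "offset b (Suc i) = offset b i + b i"
  by (simp add: offset_def)

lemma offset_0 [simp]: "offset b 0 = 0"
  by (simp add: offset_def)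

lemma offset_mono: "i \<le> k \<Longrightarrow> offset b i \<le> offset b k"
  unfolding offset_def by (intro sum_mono2) auto

text \<open>The least choice skips blocks of size 0. The value is meaningful only for indices below
  some offset, hence the bounds \<open>r < offset b m\<close> in the lemmas that follow.\<close>

definition block_of :: "(nat \<Rightarrow> nat) \<Rightarrow> nat \<Rightarrow> nat" where
  "block_of b r = (LEAST i. r < offset b (Suc i))"

lemma block_of_less_iff:
  assumes "r < offset b m"
  shows "block_of b r < i \<longleftrightarrow> r < offset b i"
proof
  \<comment> \<open>Since \<open>offset b 0 = 0\<close>, the bound \<open>m\<close> is a successor;
    its predecessor is a candidate in the minimum defining \<open>block_of\<close>.\<close>
  obtain m' where "m = Suc m'" using assms by (cases m) auto
  then have "r < offset b (Suc (block_of b r))"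
    unfolding block_of_def by (intro LeastI[of "\<lambda>i. r < offset b (Suc i)" m']) (use assms in simp)
  also assume "block_of b r < i"
  then have "offset b (Suc (block_of b r)) \<le> offset b i" by (intro offset_mono) simp
  finally show "r < offset b i" .
next
  assume r: "r < offset b i"
  then obtain i' where "i = Suc i'" by (cases i) auto
  moreover have "block_of b r \<le> i'"
    unfolding block_of_def by (rule Least_le) (use r calculation in simp)
  ultimately show "block_of b r < i" by simp
qed

lemma block_of_bounds:
  assumes "r < offset b m"
  shows "offset b (block_of b r) \<le> r" "r < offset b (block_of b r) + b (block_of b r)" "block_of b r < m"
  using block_of_less_iff[OF assms, of "block_of b r"] block_of_less_iff[OF assms, of "Suc (block_of b r)"]
    block_of_less_iff[OF assms, of m] assms by auto

lemma block_of_eq_iff: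
  assumes "r < offset b m"
  shows "block_of b r = i \<longleftrightarrow> r \<in> block_indices b i"
  using block_of_less_iff[OF assms, of i] block_of_less_iff[OF assms, of "Suc i"]
  unfolding block_indices_def by auto

lemma diag_block_mat_map_carrier:
  assumes "\<And>i. i < m \<Longrightarrow> F i \<in> carrier_mat (b i) (b i)"
  shows "diag_block_mat (map F [0..<m]) \<in> carrier_mat (offset b m) (offset b m)"
  using assms
proof (induction m)
  case (Suc m)
  then show ?case by (auto simp: diag_block_mat_last Let_def)
qed (auto simp: zero_carrier_mat)

text \<open>Induction splits off the last block, on which the offsets of the earlier blocks do not
  depend.\<close>

lemma diag_block_mat_map_index:
  assumes "\<And>i. i < m \<Longrightarrow> F i \<in> carrier_mat (b i) (b i)"
    and "r < offset b m" "c < offset b m"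
  shows "diag_block_mat (map F [0..<m]) $$ (r, c) =
    (if block_of b r = block_of b c
     then F (block_of b r) $$ (r - offset b (block_of b r), c - offset b (block_of b r)) else 0)"
  using assms
proof (induction m)
  case (Suc m)
  let ?A = "diag_block_mat (map F [0..<m])"
  have A: "?A \<in> carrier_mat (offset b m) (offset b m)"
    using Suc.prems by (intro diag_block_mat_map_carrier) auto
  have F: "F m \<in> carrier_mat (b m) (b m)" using Suc.prems by auto
  have blk: "x < offset b m \<longleftrightarrow> block_of b x < m" "\<not> x < offset b m \<Longrightarrow> block_of b x = m"
    if "x < offset b (Suc m)" for x
    using block_of_less_iff[OF that, of m] block_of_less_iff[OF that, of "Suc m"] that by auto
  have "diag_block_mat (map F [0..<Suc m]) $$ (r, c) =
    (if r < offset b m then if c < offset b m then ?A $$ (r, c) else 0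
     else if c < offset b m then 0 else F m $$ (r - offset b m, c - offset b m))"
    using A F Suc.prems(2,3) by (auto simp: diag_block_mat_last Let_def)
  then show ?case
    using Suc.IH Suc.prems blk[OF Suc.prems(2)] blk[OF Suc.prems(3)] by auto
qed simp

section \<open>Submatrices, inverses and Schur complements in terms of entries\<close>

text \<open>Exactly \<open>i\<close> elements of the interval lie below
  \<open>x + i\<close>.\<close>

lemma pick_atLeastLessThan: "i < y - x \<Longrightarrow> pick {x..<y} i = x + i"
proof -
  assume i: "i < y - x"
  then have "{a \<in> {x..<y}. a < x + i} = {x..<x + i}" by auto
  then show ?thesis using i pick_card_in_set[of "x + i" "{x..<y}"] by simp
qed

lemma submatrix_atLeastLessThan:
  assumes "H \<in> carrier_mat n n" "y \<le> n" "y' \<le> n"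
  shows "submatrix H {x..<y} {x'..<y'} = mat (y - x) (y' - x') (\<lambda>(r, c). H $$ (x + r, x' + c))"
proof -
  have "{i. i < n \<and> x \<le> i \<and> i < y} = {x..<y}" "{i. i < n \<and> x' \<le> i \<and> i < y'} = {x'..<y'}"
    using assms by auto
  with assms(1) show ?thesis
    unfolding submatrix_def by (intro eq_matI) (auto simp: pick_atLeastLessThan)
qed

text \<open>\<open>mat_inverse\<close> returns \<open>None\<close> only for non-units of the matrix
  ring, so the inverse provided by \<open>invertible_mat\<close> is presented as a witness for a
  unit.\<close>

lemma invertible_mat_inverse:
  fixes A :: "'a :: field mat"
  assumes A: "A \<in> carrier_mat m m" and inv: "invertible_mat A"
  obtains B where "mat_inverse A = Some B" "B * A = 1\<^sub>m m" "B \<in> carrier_mat m m"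
proof -
  obtain C where C: "A * C = 1\<^sub>m m" "C * A = 1\<^sub>m (dim_row C)"
    using inv A unfolding invertible_mat_def inverts_mat_def by auto
  \<comment> \<open>The definition of \<open>invertible_mat\<close> does not fix the dimensions of
    the inverse; they are read off from the two identity matrices.\<close>
  have "dim_col C = m" using arg_cong[OF C(1), of dim_col] by simp
  moreover have "dim_row C = m" using arg_cong[OF C(2), of dim_col] A by simp
  ultimately have "A \<in> Units (ring_mat TYPE('a) m ())"
    using A C by (auto simp: Units_def ring_mat_def intro!: bexI[of _ C])
  then obtain B where "mat_inverse A = Some B"
    using mat_inverse(1)[OF A, where b = "()"] by (cases "mat_inverse A") auto
  with mat_inverse(2)[OF A this] show thesis using that by blast
qed

lemma invertible_mat_left_inverse_entries:
  fixes h :: "nat \<Rightarrow> nat \<Rightarrow> 'a :: field"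
  assumes "invertible_mat (mat m m (\<lambda>(r, c). h r c))"
  obtains B where
    "\<And>r t. r < m \<Longrightarrow> t < m \<Longrightarrow> (\<Sum>q<m. B r q * h q t) = (if r = t then 1 else 0)"
    "mat_inverse (mat m m (\<lambda>(r, c). h r c)) = Some (mat m m (\<lambda>(r, c). B r c))"
proof -
  let ?A = "mat m m (\<lambda>(r, c). h r c)"
  obtain B where B: "mat_inverse ?A = Some B" "B * ?A = 1\<^sub>m m" "B \<in> carrier_mat m m"
    using invertible_mat_inverse[of ?A m] assms by auto
  show thesis
  proof (rule that[of "\<lambda>r c. B $$ (r, c)"])
    fix r t assume rt: "r < m" "t < m"
    have "(\<Sum>q<m. B $$ (r, q) * h q t) = (B * ?A) $$ (r, t)"
      using rt B(3) by (simp add: scalar_prod_def lessThan_atLeast0)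
    also have "\<dots> = (if r = t then 1 else 0)" unfolding B(2) using rt by simp
    finally show "(\<Sum>q<m. B $$ (r, q) * h q t) = (if r = t then 1 else 0)" .
  next
    have "mat m m (\<lambda>(r, c). B $$ (r, c)) = B" using B(3) by (intro eq_matI) auto
    then show "mat_inverse ?A = Some (mat m m (\<lambda>(r, c). B $$ (r, c)))" using B(1) by simp
  qed
qed

lemma block_lt_eq:
  assumes "H \<in> carrier_mat n n" "offset b i \<le> n"
  shows "block_lt b H i = mat (offset b i) (offset b i) (\<lambda>(r, c). H $$ (r, c))"
  unfolding block_lt_def lessThan_atLeast0
  using submatrix_atLeastLessThan[OF assms(1), of "offset b i" "offset b i" 0 0] assms(2) by simp

lemma block_diagonal_eq:
  assumes "H \<in> carrier_mat n n" "offset b (Suc i) \<le> n"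
  shows "block b H i i = mat (b i) (b i) (\<lambda>(r, c). H $$ (offset b i + r, offset b i + c))"
  unfolding block_def block_indices_def
  using submatrix_atLeastLessThan[OF assms(1,2,2), of "offset b i" "offset b i"] by simp

lemma block_row_lt_eq:
  assumes "H \<in> carrier_mat n n" "offset b (Suc i) \<le> n"
  shows "block_row_lt b H i = mat (b i) (offset b i) (\<lambda>(r, c). H $$ (offset b i + r, c))"
  unfolding block_row_lt_def block_indices_def lessThan_atLeast0
  using submatrix_atLeastLessThan[OF assms, of "offset b i" "offset b i" 0] assms(2) by simp

lemma schur_complement_carrier:
  assumes "H \<in> carrier_mat n n" "offset b (Suc i) \<le> n"
  shows "schur_complement b H i \<in> carrier_mat (b i) (b i)"
  using block_diagonal_eq[OF assms] block_row_lt_eq[OF assms]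
  by (intro carrier_matI) (auto simp: schur_complement_def)

text \<open>One and the same \<open>B\<close> serves as the left inverse required by
  \<open>graded_eigenpair\<close> and as the inverse inside \<open>schur_complement\<close>.\<close>

lemma schur_complement_index:
  assumes H: "H \<in> carrier_mat n n" "transpose_mat H = H" and i: "offset b (Suc i) \<le> n"
    and ex: "schur_exists b H i"
  obtains B where
    "\<And>r t. r < offset b i \<Longrightarrow> t < offset b i \<Longrightarrow>
       (\<Sum>q<offset b i. B r q * H $$ (q, t)) = (if r = t then 1 else 0)"
    "\<And>r c. r \<in> block_indices b i \<Longrightarrow> c \<in> block_indices b i \<Longrightarrow>
       schur_complement b H i $$ (r - offset b i, c - offset b i) =
       schur_entry (offset b i) B (\<lambda>r c. H $$ (r, c)) r c"
proof -
  let ?m = "offset b i"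
  note bl = block_diagonal_eq[OF H(1) i] and row = block_row_lt_eq[OF H(1) i]
  have lt: "block_lt b H i = mat ?m ?m (\<lambda>(r, c). H $$ (r, c))"
    using i by (intro block_lt_eq[OF H(1)]) simp
  show thesis
  proof (cases "i = 0")
    case True
    show thesis
    \<comment> \<open>For \<open>i = 0\<close> the leading part is empty and so are all sums over
      \<open>B\<close>; any function would serve.\<close>
    proof (rule that[of "\<lambda>_ _. 0"])
      show "schur_complement b H i $$ (r - offset b i, c - offset b i) =
          schur_entry (offset b i) (\<lambda>_ _. 0) (\<lambda>r c. H $$ (r, c)) r c"
        if "r \<in> block_indices b i" "c \<in> block_indices b i" for r c
        using that bl True by (simp add: schur_complement_def schur_entry_def block_indices_def)
    qed (use True in auto)
  next
    case False
    obtain B where B: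
      "\<And>r t. r < ?m \<Longrightarrow> t < ?m \<Longrightarrow> (\<Sum>q<?m. B r q * H $$ (q, t)) = (if r = t then 1 else 0)"
      "mat_inverse (mat ?m ?m (\<lambda>(r, c). H $$ (r, c))) = Some (mat ?m ?m (\<lambda>(r, c). B r c))"
    proof (rule invertible_mat_left_inverse_entries[of ?m "\<lambda>r c. H $$ (r, c)"], goal_cases)
      case 1
      show ?case using ex False by (simp add: schur_exists_def lt)
    next
      case (2 B)
      show ?case by (rule 2(1)[OF 2(2,3)])
    qed
    show thesis
    proof (rule that[of B])
      show "(\<Sum>q<?m. B r q * H $$ (q, t)) = (if r = t then 1 else 0)" if "r < ?m" "t < ?m" for r t
        using B(1) that .
    next
      fix r c assume rc: "r \<in> block_indices b i" "c \<in> block_indices b i"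
      then have rc': "r - ?m < b i" "c - ?m < b i" "?m + (r - ?m) = r" "?m + (c - ?m) = c"
        by (auto simp: block_indices_def)
      \<comment> \<open>\<open>schur_complement\<close> multiplies by the transposed block row where
        \<open>schur_entry\<close> has the block column; symmetry of \<open>H\<close> identifies the
        two.\<close>
      have sym: "H $$ (c, q) = H $$ (q, c)" if "q < ?m" for q
      proof -
        have "H $$ (c, q) = transpose_mat H $$ (c, q)" using H(2) by simp
        also have "\<dots> = H $$ (q, c)"
          using rc(2) that i H(1) by (subst index_transpose_mat) (auto simp: block_indices_def)
        finally show ?thesis .
      qed
      have row_B: "block_row_lt b H i * mat ?m ?m (\<lambda>(r, c). B r c) =
          mat (b i) ?m (\<lambda>(r, q'). \<Sum>q<?m. H $$ (?m + r, q) * B q q')"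
        unfolding row by (intro eq_matI) (auto simp: scalar_prod_def lessThan_atLeast0)
      have "schur_complement b H i $$ (r - ?m, c - ?m) =
        H $$ (r, c) - (\<Sum>q'<?m. (\<Sum>q<?m. H $$ (r, q) * B q q') * H $$ (c, q'))"
        unfolding schur_complement_def lt B(2) option.sel row_B
        using False rc' by (simp add: bl row scalar_prod_def lessThan_atLeast0)
      also have "\<dots> = schur_entry ?m B (\<lambda>r c. H $$ (r, c)) r c"
        unfolding schur_entry_def
        by (subst sum.swap) (simp add: sum_distrib_right sym)
      finally show "schur_complement b H i $$ (r - ?m, c - ?m) =
        schur_entry ?m B (\<lambda>r c. H $$ (r, c)) r c" .
    qed
  qed
qed

section \<open>Reconstruction from an orthonormal eigenbasis, and diagonal scaling\<close>

text \<open>A matrix is determined by its action on a basis; for an orthonormal one the completeness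
  relation turns the eigenvector equations into the spectral sum.\<close>

lemma mat_index_spectral_sum:
  fixes N :: "real mat"
  assumes N: "N \<in> carrier_mat n n"
    and orth: "\<And>k l. k < n \<Longrightarrow> l < n \<Longrightarrow> (\<Sum>r<n. x k r * x l r) = (if k = l then 1 else 0)"
    and eigen: "\<And>k r. k < n \<Longrightarrow> r < n \<Longrightarrow> (\<Sum>c<n. N $$ (r, c) * x k c) = g k * x k r"
    and rc: "r < n" "c < n"
  shows "N $$ (r, c) = (\<Sum>k<n. g k * (x k r * x k c))"
proof -
  define U where "U = mat n n (\<lambda>(r, k). x k r)"
  have U: "U \<in> carrier_mat n n" by (simp add: U_def)
  have "transpose_mat U * U = 1\<^sub>m n"
    by (intro eq_matI) (auto simp: U_def scalar_prod_def orth simp flip: lessThan_atLeast0)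
  \<comment> \<open>For square matrices a left inverse is a right inverse: orthonormal columns
    become the completeness relation between rows.\<close>
  then have UU: "U * transpose_mat U = 1\<^sub>m n"
    using mat_mult_left_right_inverse[of "transpose_mat U" n U] U by simp
  have compl: "(\<Sum>k<n. x k t * x k c) = (if t = c then 1 else 0)" if "t < n" for t
  proof -
    have "(\<Sum>k<n. x k t * x k c) = (U * transpose_mat U) $$ (t, c)"
      using that rc by (simp add: U_def scalar_prod_def lessThan_atLeast0)
    then show ?thesis unfolding UU using that rc by simp
  qed
  have "(\<Sum>k<n. g k * (x k r * x k c)) = (\<Sum>k<n. (\<Sum>t<n. N $$ (r, t) * x k t) * x k c)"
    using rc by (intro sum.cong refl) (simp add: eigen)
  also have "\<dots> = (\<Sum>t<n. \<Sum>k<n. N $$ (r, t) * x k t * x k c)"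
    unfolding sum_distrib_right by (rule sum.swap)
  also have "\<dots> = (\<Sum>t<n. N $$ (r, t) * (\<Sum>k<n. x k t * x k c))"
    by (simp add: sum_distrib_left mult.assoc)
  also have "\<dots> = (\<Sum>t<n. if t = c then N $$ (r, t) else 0)"
    by (intro sum.cong refl) (simp add: compl)
  also have "\<dots> = N $$ (r, c)" using rc by simp
  finally show ?thesis by simp
qed

lemma diagonal_sandwich_index:
  fixes D X :: "'a :: comm_semiring_1 mat"
  assumes "D \<in> carrier_mat n n" "X \<in> carrier_mat n n"
    and D: "\<And>r c. r < n \<Longrightarrow> c < n \<Longrightarrow> D $$ (r, c) = (if r = c then d r else 0)"
    and "r < n" "c < n"
  shows "(D * X * D) $$ (r, c) = d r * X $$ (r, c) * d c"
proof -
  have "(D * X) $$ (r, t) = d r * X $$ (r, t)" if "t < n" for t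
  proof -
    have "(D * X) $$ (r, t) = (\<Sum>q<n. D $$ (r, q) * X $$ (q, t))"
      using assms that by (simp add: scalar_prod_def lessThan_atLeast0)
    also have "\<dots> = (\<Sum>q<n. if r = q then d r * X $$ (q, t) else 0)"
      using assms by (intro sum.cong) auto
    finally show ?thesis using assms by simp
  qed
  then have "(D * X * D) $$ (r, c) = (\<Sum>q<n. d r * X $$ (r, q) * D $$ (q, c))"
    using assms by (simp add: scalar_prod_def lessThan_atLeast0 del: assoc_mult_mat)
  also have "\<dots> = (\<Sum>q<n. if q = c then d r * X $$ (r, q) * d c else 0)"
    using assms by (intro sum.cong) auto
  finally show ?thesis using assms by simp
qed

lemma scaling_mat_carrier: "scaling_mat p \<nu> b \<epsilon> \<in> carrier_mat (offset b (Suc p)) (offset b (Suc p))"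
  unfolding scaling_mat_def by (intro diag_block_mat_map_carrier) simp

lemma scaling_mat_index:
  assumes "r < offset b (Suc p)" "c < offset b (Suc p)"
  shows "scaling_mat p \<nu> b \<epsilon> $$ (r, c) = (if r = c then \<epsilon> powr \<nu> (block_of b r) else 0)"
proof -
  have "scaling_mat p \<nu> b \<epsilon> $$ (r, c) = (if block_of b r = block_of b c
     then (\<epsilon> powr \<nu> (block_of b r) \<cdot>\<^sub>m 1\<^sub>m (b (block_of b r))) $$
       (r - offset b (block_of b r), c - offset b (block_of b r)) else 0)"
    unfolding scaling_mat_def using assms by (intro diag_block_mat_map_index) auto
  then show ?thesis
    using block_of_bounds[OF assms(1)] block_of_bounds[OF assms(2)] by auto
qed

section \<open>Spectral decompositions of scaled perturbations\<close>

text \<open>The decomposition is arbitrary and its eigenvalues carry no order, so the conclusions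
  hold for every choice.\<close>

locale scaled_perturbation =
  fixes p n :: nat and b :: "nat \<Rightarrow> nat" and \<nu> :: "nat \<Rightarrow> real" and H :: "real mat"
    and K :: "real \<Rightarrow> real mat" and lam :: "nat \<Rightarrow> real \<Rightarrow> real" and u :: "nat \<Rightarrow> real \<Rightarrow> real vec"
  assumes n: "n = offset b (Suc p)"
    and \<nu>_mono: "strict_mono_on {..p} \<nu>"
    and H: "H \<in> carrier_mat n n" "transpose_mat H = H"
    and K_form: "scaled_form p \<nu> b H K"
    and decomp: "analytic_spectral_decomposition n K lam u"
begin

lemma \<nu>_less: "i \<le> p \<Longrightarrow> k \<le> p \<Longrightarrow> \<nu> i < \<nu> k \<longleftrightarrow> i < k"
  using strict_mono_on_less[OF \<nu>_mono] by auto

lemma \<nu>_eq: "i \<le> p \<Longrightarrow> k \<le> p \<Longrightarrow> \<nu> i = \<nu> k \<longleftrightarrow> i = k"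
  using strict_mono_on_eqD[OF \<nu>_mono] by auto

lemma offset_le_n: "i \<le> Suc p \<Longrightarrow> offset b i \<le> n"
  unfolding n by (rule offset_mono)

lemma block_of_n:
  assumes "r < n"
  shows "block_of b r \<le> p" "block_of b r < i \<longleftrightarrow> r < offset b i"
  using block_of_bounds(3)[of r b "Suc p"] block_of_less_iff[of r b "Suc p" i] assms
  unfolding n by simp_all

lemma eigenvector_tendsto:
  assumes "k < n" "r < n"
  shows "((\<lambda>\<epsilon>. u k \<epsilon> $ r) \<longlongrightarrow> u k 0 $ r) (at_right 0)"
proof -
  have "isCont (\<lambda>\<epsilon>. u k \<epsilon> $ r) 0"
    using decomp assms unfolding analytic_spectral_decomposition_def
    by (intro analytic_at_zero_isCont) auto
  then show ?thesis unfolding isCont_def by (rule tendsto_within_subset) simp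
qed

lemma orthonormal:
  assumes "k < n" "l < n"
  shows "(\<Sum>r<n. u k 0 $ r * u l 0 $ r) = (if k = l then 1 else 0)"
proof -
  \<comment> \<open>The filter \<open>nhds 0\<close> contains the point 0 in each of its
    neighbourhoods, so the eventual relations hold at 0 itself.\<close>
  have "\<forall>k<n. u k 0 \<in> carrier_vec n" "\<forall>k<n. \<forall>l<n. u k 0 \<bullet> u l 0 = (if k = l then 1 else 0)"
    using decomp unfolding analytic_spectral_decomposition_def
    by (auto dest: eventually_nhds_x_imp_x)
  then have "dim_vec (u l 0) = n" "u k 0 \<bullet> u l 0 = (if k = l then 1 else 0)"
    using assms by auto
  then show ?thesis by (simp add: scalar_prod_def lessThan_atLeast0)
qed

lemma eigenvector_nonzero:
  assumes "k < n"
  shows "\<exists>r<n. u k 0 $ r \<noteq> 0"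
proof (rule ccontr)
  assume "\<not> (\<exists>r<n. u k 0 $ r \<noteq> 0)"
  then have "(\<Sum>r<n. u k 0 $ r * u k 0 $ r) = 0" by (intro sum.neutral) auto
  with orthonormal[OF assms assms] show False by simp
qed

lemma eigen_equation:
  obtains R where "\<And>r c. r < n \<Longrightarrow> c < n \<Longrightarrow> (R r c \<longlongrightarrow> 0) (at_right (0::real))"
    "\<And>k. k < n \<Longrightarrow> \<forall>\<^sub>F \<epsilon> in at_right 0. \<forall>r<n.
      (\<Sum>c<n. \<epsilon> powr \<nu> (block_of b r) * (H $$ (r, c) + R r c \<epsilon>) * \<epsilon> powr \<nu> (block_of b c) * u k \<epsilon> $ c)
        = lam k \<epsilon> * u k \<epsilon> $ r"
proof -
  let ?S = "scaling_mat p \<nu> b"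
  obtain R where R: "\<And>\<epsilon>. R \<epsilon> \<in> carrier_mat n n"
    "\<And>r c. r < n \<Longrightarrow> c < n \<Longrightarrow> ((\<lambda>\<epsilon>. R \<epsilon> $$ (r, c)) \<longlongrightarrow> 0) (at_right 0)"
    "\<forall>\<^sub>F \<epsilon> in at_right 0. K \<epsilon> = ?S \<epsilon> * (H + R \<epsilon>) * ?S \<epsilon>"
    using K_form unfolding scaled_form_def n[symmetric] Let_def by blast
  have dec: "\<forall>\<^sub>F \<epsilon> in at_right 0. \<forall>k<n. u k \<epsilon> \<in> carrier_vec n \<and> K \<epsilon> *\<^sub>v u k \<epsilon> = lam k \<epsilon> \<cdot>\<^sub>v u k \<epsilon>"
    using decomp unfolding analytic_spectral_decomposition_def
    by (auto simp: eventually_at_filter elim: eventually_mono)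
  show thesis
  proof (rule that[of "\<lambda>r c \<epsilon>. R \<epsilon> $$ (r, c)"])
    fix k assume k: "k < n"
    show "\<forall>\<^sub>F \<epsilon> in at_right 0. \<forall>r<n.
      (\<Sum>c<n. \<epsilon> powr \<nu> (block_of b r) * (H $$ (r, c) + R \<epsilon> $$ (r, c)) * \<epsilon> powr \<nu> (block_of b c) * u k \<epsilon> $ c)
        = lam k \<epsilon> * u k \<epsilon> $ r"
      using R(3) dec
    proof eventually_elim
      case (elim \<epsilon>)
      have S: "?S \<epsilon> \<in> carrier_mat n n" unfolding n by (rule scaling_mat_carrier)
      have X: "H + R \<epsilon> \<in> carrier_mat n n" using H R by simp
      have uk: "u k \<epsilon> \<in> carrier_vec n" using elim k by simp
      show ?case
      proof (intro allI impI)
        fix r assume r: "r < n"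
        have "K \<epsilon> $$ (r, c) = \<epsilon> powr \<nu> (block_of b r) * (H $$ (r, c) + R \<epsilon> $$ (r, c)) * \<epsilon> powr \<nu> (block_of b c)"
          if "c < n" for c
          unfolding elim(1) using diagonal_sandwich_index[OF S X, of "\<lambda>r. \<epsilon> powr \<nu> (block_of b r)" r c]
            scaling_mat_index[of _ b p _ \<nu> \<epsilon>, folded n] that r H R(1)[of \<epsilon>] by auto
        then have "(\<Sum>c<n. \<epsilon> powr \<nu> (block_of b r) * (H $$ (r, c) + R \<epsilon> $$ (r, c)) * \<epsilon> powr \<nu> (block_of b c) * u k \<epsilon> $ c)
          = (\<Sum>c<n. K \<epsilon> $$ (r, c) * u k \<epsilon> $ c)" by simp
        also have "\<dots> = (K \<epsilon> *\<^sub>v u k \<epsilon>) $ r"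
          using S uk r elim(1) by (simp add: scalar_prod_def lessThan_atLeast0)
        also have "\<dots> = lam k \<epsilon> * u k \<epsilon> $ r" using elim(2) k r uk by (metis carrier_vecD index_smult_vec(1))
        finally show "(\<Sum>c<n. \<epsilon> powr \<nu> (block_of b r) * (H $$ (r, c) + R \<epsilon> $$ (r, c)) * \<epsilon> powr \<nu> (block_of b c) * u k \<epsilon> $ c)
          = lam k \<epsilon> * u k \<epsilon> $ r" .
      qed
    qed
  qed (use R in auto)
qed

section \<open>Location of the limiting eigenvectors\<close>

text \<open>The eigenvalue is negligible against the squared weights of all blocks up to
  \<open>j\<close>. These blocks are thus the low rows of a \<open>graded_eigenpair\<close>, and
  \<open>v0_low\<close> applies.\<close>

lemma small_eigenvalue_support:
  assumes j: "j \<le> p" and inv: "invertible_mat (block_le b H j j)" and k: "k < n"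
    and val: "\<not> ereal_of_enat (valuation (lam k)) \<le> ereal (2 * \<nu> j)"
    and r: "r < offset b (Suc j)"
  shows "u k 0 $ r = 0"
proof -
  let ?m = "offset b (Suc j)"
  obtain R where R: "\<And>r c. r < n \<Longrightarrow> c < n \<Longrightarrow> (R r c \<longlongrightarrow> 0) (at_right (0::real))"
    "\<And>k. k < n \<Longrightarrow> \<forall>\<^sub>F \<epsilon> in at_right 0. \<forall>r<n.
      (\<Sum>c<n. \<epsilon> powr \<nu> (block_of b r) * (H $$ (r, c) + R r c \<epsilon>) * \<epsilon> powr \<nu> (block_of b c) * u k \<epsilon> $ c)
        = lam k \<epsilon> * u k \<epsilon> $ r"
    using eigen_equation by blast
  have "block_le b H j j = block_lt b H (Suc j)" by (simp add: block_le_def block_lt_def)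
  also have "\<dots> = mat ?m ?m (\<lambda>(r, c). H $$ (r, c))"
    by (intro block_lt_eq[OF H(1)] offset_le_n) (use j in simp)
  finally obtain B where B:
    "\<And>r t. r < ?m \<Longrightarrow> t < ?m \<Longrightarrow> (\<Sum>q<?m. B r q * H $$ (q, t)) = (if r = t then 1 else 0)"
    using invertible_mat_left_inverse_entries[of ?m "\<lambda>r c. H $$ (r, c)"] inv by metis
  \<comment> \<open>The scale must exceed \<open>\<nu> j\<close> and not exceed any later exponent.
    For \<open>j = p\<close> no rows remain above, and \<open>\<nu> j + 1\<close> is an arbitrary
    such level.\<close>
  define s where "s = (if j < p then \<nu> (Suc j) else \<nu> j + 1)"
  interpret graded_eigenpair n ?m s "\<lambda>r. \<nu> (block_of b r)" "\<lambda>r c. H $$ (r, c)" B R "lam k"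
    "\<lambda>r \<epsilon>. u k \<epsilon> $ r" "\<lambda>r. u k 0 $ r"
  proof
    show m_n: "?m \<le> n" using j by (intro offset_le_n) simp
    have blk: "block_of b r \<le> j" if "r < ?m" for r
      using block_of_n(2)[of r "Suc j"] that m_n by simp
    have le_j: "\<nu> (block_of b r) \<le> \<nu> j" if "r < ?m" for r
      using blk[OF that] \<nu>_less[of j "block_of b r"] j by force
    show "\<nu> (block_of b r) < s" if "r < ?m" for r
      using le_j[OF that] \<nu>_less[of j "Suc j"] unfolding s_def by (cases "j < p") auto
    show "s \<le> \<nu> (block_of b r)" if "?m \<le> r" "r < n" for r
      using block_of_n(1)[OF that(2)] block_of_n(2)[OF that(2), of "Suc j"] that(1) \<nu>_less[of "block_of b r" "Suc j"]
      unfolding s_def by (cases "j < p") force+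
    show "((\<lambda>\<epsilon>. lam k \<epsilon> * \<epsilon> powr (- 2 * \<nu> (block_of b r))) \<longlongrightarrow> 0) (at_right 0)" if "r < ?m" for r
    proof (cases "vanishes_near_zero (lam k)")
      \<comment> \<open>Valuation \<infinity> also exceeds the bound, but there is no leading form;
        the product is eventually 0.\<close>
      case True
      then have "\<forall>\<^sub>F \<epsilon> in at_right 0. lam k \<epsilon> * \<epsilon> powr (- 2 * \<nu> (block_of b r)) = 0"
        unfolding vanishes_near_zero_def by (auto simp: eventually_at_filter elim: eventually_mono)
      then show ?thesis by (rule tendsto_eventually)
    next
      case False
      then obtain \<alpha> c where lf: "leading_form (lam k) \<alpha> c"
        using leading_form_exists decomp k unfolding analytic_spectral_decomposition_def by blast
      have "2 * \<nu> j < \<alpha>" using val leading_form_valuation(1)[OF lf] by simp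
      with le_j[OF that] show ?thesis by (intro leading_form_scaled_tendsto_0[OF lf]) simp
    qed
  qed (use R B k eigenvector_tendsto in auto)
  show ?thesis using v0_low r .
qed

text \<open>The critical block is the first one against whose squared weight the eigenvalue is not
  negligible. At its scale, comparing exponents row by row with \<open>eigenvalue_high\<close> fixes
  the valuation, the support and the eigenvector equation.\<close>

lemma large_eigenvalue_block:
  assumes j: "j \<le> p" and schur: "\<And>i. i \<le> j \<Longrightarrow> schur_exists b H i" and k: "k < n"
    and lf: "leading_form (lam k) \<alpha> c" and \<alpha>: "real \<alpha> \<le> 2 * \<nu> j"
  obtains i where "i \<le> j" "real \<alpha> = 2 * \<nu> i" "\<And>r. r < n \<Longrightarrow> block_of b r \<noteq> i \<Longrightarrow> u k 0 $ r = 0"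
    "\<And>r. r \<in> block_indices b i \<Longrightarrow> (\<Sum>t\<in>block_indices b i.
       schur_complement b H i $$ (r - offset b i, t - offset b i) * u k 0 $ t) = c * u k 0 $ r"
proof -
  obtain R where R: "\<And>r c. r < n \<Longrightarrow> c < n \<Longrightarrow> (R r c \<longlongrightarrow> 0) (at_right (0::real))"
    "\<And>k. k < n \<Longrightarrow> \<forall>\<^sub>F \<epsilon> in at_right 0. \<forall>r<n.
      (\<Sum>c<n. \<epsilon> powr \<nu> (block_of b r) * (H $$ (r, c) + R r c \<epsilon>) * \<epsilon> powr \<nu> (block_of b c) * u k \<epsilon> $ c)
        = lam k \<epsilon> * u k \<epsilon> $ r"
    using eigen_equation by blast
  \<comment> \<open>The candidate \<open>j\<close> bounds the minimum, and minimality makes every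
    earlier block satisfy \<open>below\<close>, which is what \<open>l_small\<close> needs.\<close>
  define i where "i = (LEAST i. real \<alpha> \<le> 2 * \<nu> i)"
  have \<alpha>_i: "real \<alpha> \<le> 2 * \<nu> i" unfolding i_def by (rule LeastI[of "\<lambda>i. real \<alpha> \<le> 2 * \<nu> i", OF \<alpha>])
  have i_j: "i \<le> j" unfolding i_def by (rule Least_le[of "\<lambda>i. real \<alpha> \<le> 2 * \<nu> i", OF \<alpha>])
  have below: "2 * \<nu> q < real \<alpha>" if "q < i" for q
    using not_less_Least[of q "\<lambda>i. real \<alpha> \<le> 2 * \<nu> i"] that unfolding i_def by auto
  let ?m = "offset b i"
  have i_n: "offset b (Suc i) \<le> n" using i_j j by (intro offset_le_n) simp
  obtain B where B:
    "\<And>r t. r < ?m \<Longrightarrow> t < ?m \<Longrightarrow> (\<Sum>q<?m. B r q * H $$ (q, t)) = (if r = t then 1 else 0)"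
    "\<And>r c. r \<in> block_indices b i \<Longrightarrow> c \<in> block_indices b i \<Longrightarrow>
       schur_complement b H i $$ (r - ?m, c - ?m) = schur_entry ?m B (\<lambda>r c. H $$ (r, c)) r c"
  proof (rule schur_complement_index[OF H i_n schur[OF i_j]], goal_cases)
    case (1 B)
    show ?case by (rule 1(1)[OF 1(2,3)])
  qed
  obtain q where q: "c \<noteq> 0" "(q \<longlongrightarrow> c) (at 0)" "\<forall>\<^sub>F \<epsilon> in at 0. lam k \<epsilon> = \<epsilon> ^ \<alpha> * q \<epsilon>"
    using leading_formE[OF lf] .
  have m_n: "?m \<le> n" using i_n by simp
  have blk_low: "block_of b r < i" if "r < ?m" for r
    using block_of_n(2)[of r i] that m_n by simp
  have blk_high: "i \<le> block_of b r" if "?m \<le> r" "r < n" for r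
    using block_of_n(2)[of r i] that by simp
  interpret graded_eigenpair n ?m "\<nu> i" "\<lambda>r. \<nu> (block_of b r)" "\<lambda>r c. H $$ (r, c)" B R "lam k"
    "\<lambda>r \<epsilon>. u k \<epsilon> $ r" "\<lambda>r. u k 0 $ r"
  proof
    show "?m \<le> n" by (rule m_n)
    show "\<nu> (block_of b r) < \<nu> i" if "r < ?m" for r
      using blk_low[OF that] \<nu>_less[of "block_of b r" i] i_j j by simp
    show "\<nu> i \<le> \<nu> (block_of b r)" if "?m \<le> r" "r < n" for r
      using blk_high[OF that] \<nu>_less[of "block_of b r" i] i_j j block_of_n(1)[OF that(2)] by force
    show "((\<lambda>\<epsilon>. lam k \<epsilon> * \<epsilon> powr (- 2 * \<nu> (block_of b r))) \<longlongrightarrow> 0) (at_right 0)" if "r < ?m" for r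
      using below[OF blk_low[OF that]] by (intro leading_form_scaled_tendsto_0[OF lf])
  qed (use R B k eigenvector_tendsto in auto)
  have q_right: "(q \<longlongrightarrow> c) (at_right 0)" "\<forall>\<^sub>F \<epsilon> in at_right 0. lam k \<epsilon> = \<epsilon> powr real \<alpha> * q \<epsilon>"
    subgoal using q(2) by (rule tendsto_within_subset) simp
    subgoal
      using filter_leD[OF at_le[of "{0<..}" UNIV] q(3)[simplified]] eventually_at_right_less[of 0]
      by (auto elim!: eventually_elim2 simp: powr_realpow)
    done
  note evh = eigenvalue_high[OF q_right(2,1)]
  \<comment> \<open>If \<alpha> were smaller, every row from \<open>?m\<close> on would be in the
    strict case of \<open>evh\<close>. Together with \<open>v0_low\<close> this annihilates the
    limiting eigenvector, which has norm 1.\<close>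
  have \<alpha>_eq: "real \<alpha> = 2 * \<nu> i"
  proof (rule ccontr)
    assume neq: "real \<alpha> \<noteq> 2 * \<nu> i"
    obtain r where r: "r < n" "u k 0 $ r \<noteq> 0" using eigenvector_nonzero[OF k] by blast
    then have mr: "?m \<le> r" using v0_low[of r] by force
    then have "real \<alpha> < \<nu> i + \<nu> (block_of b r)"
      using neq \<alpha>_i graded_eigenpair.high[OF graded_eigenpair_axioms mr r(1)] by simp
    then show False using evh[OF r(1)] q(1) r(2) by simp
  qed
  show thesis
  proof (rule that[OF i_j \<alpha>_eq])
    fix r assume r: "r < n" "block_of b r \<noteq> i"
    show "u k 0 $ r = 0"
    proof (cases "r < ?m")
      case True
      then show ?thesis by (rule v0_low)
    next
      case False
      \<comment> \<open>Beyond block \<open>i\<close> the exponent \<alpha> is strictly below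
        \<open>\<nu> i + \<nu> (block_of b r)\<close>, the strict case of
        \<open>evh\<close>.\<close>
      then have "\<nu> i < \<nu> (block_of b r)"
        using blk_high[of r] r \<nu>_less[of i "block_of b r"] block_of_n(1)[OF r(1)] i_j j by force
      then show ?thesis using evh[OF r(1)] \<alpha>_eq q(1) by simp
    qed
  next
    fix r assume r: "r \<in> block_indices b i"
    have blk: "t < n" "block_of b t = i" if "t \<in> block_indices b i" for t
      using that i_n block_of_eq_iff[of t b "Suc p" i] unfolding n[symmetric] by (auto simp: block_indices_def)
    \<comment> \<open>The exponents of different blocks differ, so \<open>z\<close> retains block
      \<open>i\<close> alone.\<close>
    have z_eq: "z t = (if t \<in> block_indices b i then u k 0 $ t else 0)" if "t < n" for t
      using that \<nu>_eq[of "block_of b t" i] block_of_n(1)[OF that] i_j j block_of_eq_iff[of t b "Suc p" i]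
      unfolding z_def n[symmetric] by auto
    have "(\<Sum>t\<in>block_indices b i. schur_complement b H i $$ (r - ?m, t - ?m) * u k 0 $ t)
      = (\<Sum>t\<in>block_indices b i. schur_entry ?m B (\<lambda>r c. H $$ (r, c)) r t * z t)"
      by (intro sum.cong refl) (simp add: B(2) r z_eq blk)
    also have "\<dots> = (\<Sum>t\<in>{?m..<n}. schur_entry ?m B (\<lambda>r c. H $$ (r, c)) r t * z t)"
      by (intro sum.mono_neutral_left) (use i_n in \<open>auto simp: z_eq block_indices_def\<close>)
    also have "\<dots> = c * u k 0 $ r"
      using evh[OF blk(1)[OF r]] \<alpha>_eq blk(2)[OF r] by simp
    finally show "(\<Sum>t\<in>block_indices b i. schur_complement b H i $$ (r - ?m, t - ?m) * u k 0 $ t) = c * u k 0 $ r" .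
  qed
qed

section \<open>Assembly of the asymptotic spectral equivalent\<close>

text \<open>The vectors \<open>u k 0\<close> form an orthonormal eigenbasis of \<open>N\<close>
  whose eigenvalues are the retained leading terms, with 0 for the discarded ones; hence
  \<open>N\<close> is the truncated spectral sum.\<close>

lemma block_diagonal_spectral_sum:
  assumes j: "j \<le> p" and inv: "invertible_mat (block_le b H j j)"
    and schur: "\<And>i. i \<le> j \<Longrightarrow> schur_exists b H i" and \<epsilon>: "\<epsilon> > 0"
    and N: "N \<in> carrier_mat n n" "\<And>r c. r < n \<Longrightarrow> c < n \<Longrightarrow> N $$ (r, c) =
      (if block_of b r = block_of b c \<and> block_of b r \<le> j
       then \<epsilon> powr (2 * \<nu> (block_of b r)) * schur_complement b H (block_of b r) $$
         (r - offset b (block_of b r), c - offset b (block_of b r)) else 0)"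
  shows "N = trunc_ase (2 * \<nu> j) n lam u \<epsilon>"
proof -
  define g where "g k = (if ereal_of_enat (valuation (lam k)) \<le> ereal (2 * \<nu> j) then leading_term (lam k) \<epsilon> else 0)" for k
  have eig: "(\<Sum>t<n. N $$ (r, t) * u k 0 $ t) = g k * u k 0 $ r" if k: "k < n" and r: "r < n" for k r
  proof (cases "ereal_of_enat (valuation (lam k)) \<le> ereal (2 * \<nu> j)")
    case False
    \<comment> \<open>In blocks up to \<open>j\<close> the vector vanishes; in later blocks the
      column of \<open>N\<close> does.\<close>
    have "N $$ (r, t) * u k 0 $ t = 0" if t: "t < n" for t
      using small_eigenvalue_support[OF j inv k False, of t] block_of_n(2)[OF t, of "Suc j"] N(2)[OF r t] by auto
    then have "(\<Sum>t<n. N $$ (r, t) * u k 0 $ t) = 0" by (intro sum.neutral) auto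
    then show ?thesis using False by (simp add: g_def)
  next
    case True
    then have "\<not> vanishes_near_zero (lam k)" by (auto simp: valuation_def)
    then obtain \<alpha> c where lf: "leading_form (lam k) \<alpha> c"
      using leading_form_exists decomp k unfolding analytic_spectral_decomposition_def by blast
    have "real \<alpha> \<le> 2 * \<nu> j" using True leading_form_valuation(1)[OF lf] by simp
    then obtain i where i: "i \<le> j" "real \<alpha> = 2 * \<nu> i" "\<And>r. r < n \<Longrightarrow> block_of b r \<noteq> i \<Longrightarrow> u k 0 $ r = 0"
      "\<And>r. r \<in> block_indices b i \<Longrightarrow> (\<Sum>t\<in>block_indices b i.
         schur_complement b H i $$ (r - offset b i, t - offset b i) * u k 0 $ t) = c * u k 0 $ r"
      using large_eigenvalue_block[OF j schur k lf] by blast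
    \<comment> \<open>The real exponent \<open>2 * \<nu> i\<close> equals the natural number
      \<alpha>; for positive \<open>\<epsilon>\<close> both kinds of power agree.\<close>
    have "\<epsilon> powr (2 * \<nu> i) = \<epsilon> ^ \<alpha>" using i(2) \<epsilon> by (simp flip: powr_realpow)
    then have gk: "g k = \<epsilon> powr (2 * \<nu> i) * c"
      using True leading_form_valuation(2)[OF lf] by (simp add: g_def)
    have blk: "t \<in> block_indices b i \<longleftrightarrow> block_of b t = i" if "t < n" for t
      using block_of_eq_iff[of t b "Suc p" i] that unfolding n by auto
    have sub: "block_indices b i \<subseteq> {..<n}"
      using offset_le_n[of "Suc i"] i(1) j by (auto simp: block_indices_def)
    have "(\<Sum>t<n. N $$ (r, t) * u k 0 $ t) = (\<Sum>t\<in>block_indices b i. N $$ (r, t) * u k 0 $ t)"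
      by (intro sum.mono_neutral_right sub) (auto simp: blk i(3))
    also have "\<dots> = g k * u k 0 $ r"
    proof (cases "block_of b r = i")
      case True
      have "(\<Sum>t\<in>block_indices b i. N $$ (r, t) * u k 0 $ t) = (\<Sum>t\<in>block_indices b i.
        \<epsilon> powr (2 * \<nu> i) * (schur_complement b H i $$ (r - offset b i, t - offset b i) * u k 0 $ t))"
      proof (intro sum.cong refl)
        fix t assume t: "t \<in> block_indices b i"
        then have "t < n" using sub by auto
        with t show "N $$ (r, t) * u k 0 $ t =
          \<epsilon> powr (2 * \<nu> i) * (schur_complement b H i $$ (r - offset b i, t - offset b i) * u k 0 $ t)"
          using N(2)[OF r] blk True i(1) by simp
      qed
      also have "\<dots> = \<epsilon> powr (2 * \<nu> i) * (c * u k 0 $ r)"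
        unfolding sum_distrib_left[symmetric] using i(4)[of r] blk[OF r] True by simp
      finally show ?thesis by (simp add: gk)
    next
      case False
      have "N $$ (r, t) * u k 0 $ t = 0" if "t \<in> block_indices b i" for t
        using that sub False N(2)[OF r, of t] blk[of t] by auto
      then have "(\<Sum>t\<in>block_indices b i. N $$ (r, t) * u k 0 $ t) = 0" by (intro sum.neutral) auto
      then show ?thesis using i(3)[OF r False] by simp
    qed
    finally show ?thesis .
  qed
  show ?thesis
  proof (rule eq_matI)
    fix r c assume "r < dim_row (trunc_ase (2 * \<nu> j) n lam u \<epsilon>)" "c < dim_col (trunc_ase (2 * \<nu> j) n lam u \<epsilon>)"
    then have rc: "r < n" "c < n" by (simp_all add: trunc_ase_def)
    have "N $$ (r, c) = (\<Sum>k<n. g k * (u k 0 $ r * u k 0 $ c))"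
      using orthonormal eig rc by (intro mat_index_spectral_sum[OF N(1)]) auto
    also have "\<dots> = trunc_ase (2 * \<nu> j) n lam u \<epsilon> $$ (r, c)"
      using rc unfolding trunc_ase_def g_def
      by (auto simp: if_distrib[of "\<lambda>x. x * _"] sum.If_cases intro!: sum.cong)
    finally show "N $$ (r, c) = trunc_ase (2 * \<nu> j) n lam u \<epsilon> $$ (r, c)" .
  qed (use N(1) in \<open>auto simp: trunc_ase_def\<close>)
qed

text \<open>Nothing is cut off: an eigenvalue of valuation above \<open>2 * \<nu> p\<close> would
  have a limiting eigenvector vanishing in all blocks.\<close>

lemma ase_eq_trunc_ase:
  assumes inv: "invertible_mat (block_le b H p p)"
  shows "ase n lam u \<epsilon> = trunc_ase (2 * \<nu> p) n lam u \<epsilon>"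
proof -
  have "ereal_of_enat (valuation (lam k)) \<le> ereal (2 * \<nu> p)" if k: "k < n" for k
    using small_eigenvalue_support[OF order_refl inv k] eigenvector_nonzero[OF k] unfolding n by blast
  then have "{k. k < n \<and> ereal_of_enat (valuation (lam k)) \<le> ereal (2 * \<nu> p)} = {k. k < n}" by auto
  then show ?thesis by (simp add: ase_def trunc_ase_def)
qed

end

theorem theorem4p2:
  fixes p j n :: nat
    and b :: "nat \<Rightarrow> nat"
    and \<nu> :: "nat \<Rightarrow> real"
    and H :: "real mat"
    and K :: "real \<Rightarrow> real mat"
    and lam :: "nat \<Rightarrow> real \<Rightarrow> real"
    and u :: "nat \<Rightarrow> real \<Rightarrow> real vec"
  assumes n: "n = offset b (Suc p)"
    and b_pos: "\<And>i. i \<le> p \<Longrightarrow> 0 < b i"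
    and \<nu>_mono: "strict_mono_on {..p} \<nu>"
    and H: "H \<in> carrier_mat n n" "transpose_mat H = H"
    and K: "analytic_symmetric n K"
    and K_form: "scaled_form p \<nu> b H K"
    and j: "j \<le> p"
    and inv: "invertible_mat (block_le b H j j)"
    and schur: "\<And>i. i \<le> j \<Longrightarrow> schur_exists b H i"
    and decomp: "analytic_spectral_decomposition n K lam u"
  shows "(\<forall>\<epsilon>>0. trunc_ase (2 * \<nu> j) n lam u \<epsilon> =
            diag_block_mat
              (map (\<lambda>i. (\<epsilon> powr (2 * \<nu> i)) \<cdot>\<^sub>m schur_complement b H i) [0..<Suc j] @
               [0\<^sub>m (n - offset b (Suc j)) (n - offset b (Suc j))]))
       \<and> (j = p \<longrightarrow> (\<forall>\<epsilon>>0. ase n lam u \<epsilon> =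
            diag_block_mat
              (map (\<lambda>i. (\<epsilon> powr (2 * \<nu> i)) \<cdot>\<^sub>m schur_complement b H i) [0..<Suc p])))"
proof -
  interpret scaled_perturbation p n b \<nu> H K lam u
    by unfold_locales fact+
  let ?m = "offset b (Suc j)"
  have m_n: "?m \<le> n" using j by (intro offset_le_n) simp
  have S: "schur_complement b H i \<in> carrier_mat (b i) (b i)" if "i \<le> j" for i
    using that j by (intro schur_complement_carrier[OF H(1)] offset_le_n) simp
  have trunc: "diag_block_mat (map (\<lambda>i. \<epsilon> powr (2 * \<nu> i) \<cdot>\<^sub>m schur_complement b H i) [0..<Suc j] @
      [0\<^sub>m (n - ?m) (n - ?m)]) = trunc_ase (2 * \<nu> j) n lam u \<epsilon>" if \<epsilon>: "\<epsilon> > 0" for \<epsilon>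
  proof -
    let ?F = "\<lambda>i. \<epsilon> powr (2 * \<nu> i) \<cdot>\<^sub>m schur_complement b H i"
    let ?D = "diag_block_mat (map ?F [0..<Suc j])"
    have F: "?F i \<in> carrier_mat (b i) (b i)" if "i < Suc j" for i
      using S[of i] that by simp
    have D: "?D \<in> carrier_mat ?m ?m" by (rule diag_block_mat_map_carrier) (rule F)
    \<comment> \<open>The trailing zero block is split off, since it is not one of the blocks
      counted by \<open>b\<close>; it is empty when \<open>j = p\<close>.\<close>
    have N: "diag_block_mat (map ?F [0..<Suc j] @ [0\<^sub>m (n - ?m) (n - ?m)]) =
      four_block_mat ?D (0\<^sub>m ?m (n - ?m)) (0\<^sub>m (n - ?m) ?m) (0\<^sub>m (n - ?m) (n - ?m))"
      using D unfolding diag_block_mat_last Let_def by (simp only: carrier_matD index_zero_mat)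
    show ?thesis unfolding N
    proof (rule block_diagonal_spectral_sum[OF j inv schur \<epsilon>])
      show "four_block_mat ?D (0\<^sub>m ?m (n - ?m)) (0\<^sub>m (n - ?m) ?m) (0\<^sub>m (n - ?m) (n - ?m)) \<in> carrier_mat n n"
        using four_block_carrier_mat[OF D, of "0\<^sub>m (n - ?m) (n - ?m)" "n - ?m" "n - ?m"] m_n by simp
      fix r c assume rc: "r < n" "c < n"
      have "four_block_mat ?D (0\<^sub>m ?m (n - ?m)) (0\<^sub>m (n - ?m) ?m) (0\<^sub>m (n - ?m) (n - ?m)) $$ (r, c) =
        (if r < ?m \<and> c < ?m then ?D $$ (r, c) else 0)"
        using D rc m_n by (subst index_mat_four_block) (auto simp del: offset_Suc upt_Suc)
      also have "\<dots> = (if block_of b r = block_of b c \<and> block_of b r \<le> j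
         then \<epsilon> powr (2 * \<nu> (block_of b r)) * schur_complement b H (block_of b r) $$
         (r - offset b (block_of b r), c - offset b (block_of b r)) else 0)"
      proof (cases "r < ?m \<and> c < ?m")
        case True
        note br = block_of_bounds[OF conjunct1[OF True]] and bc = block_of_bounds[OF conjunct2[OF True]]
        have "?D $$ (r, c) = (if block_of b r = block_of b c
          then ?F (block_of b r) $$ (r - offset b (block_of b r), c - offset b (block_of b r)) else 0)"
          using True by (intro diag_block_mat_map_index F) auto
        then show ?thesis using True br bc S[of "block_of b r"] by auto
      next
        \<comment> \<open>An index is below \<open>?m\<close> exactly when its block is at most
          \<open>j\<close>, so two indices of a common block up to \<open>j\<close> cannot occur
          here.\<close>
        case False
        then show ?thesis
          using block_of_n(2)[OF rc(1), of "Suc j"] block_of_n(2)[OF rc(2), of "Suc j"] by auto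
      qed
      finally show "four_block_mat ?D (0\<^sub>m ?m (n - ?m)) (0\<^sub>m (n - ?m) ?m) (0\<^sub>m (n - ?m) (n - ?m)) $$ (r, c) =
        (if block_of b r = block_of b c \<and> block_of b r \<le> j
         then \<epsilon> powr (2 * \<nu> (block_of b r)) * schur_complement b H (block_of b r) $$
         (r - offset b (block_of b r), c - offset b (block_of b r)) else 0)" .
    qed
  qed
  have "ase n lam u \<epsilon> = diag_block_mat (map (\<lambda>i. \<epsilon> powr (2 * \<nu> i) \<cdot>\<^sub>m schur_complement b H i) [0..<Suc p])"
    if "j = p" and \<epsilon>: "\<epsilon> > 0" for \<epsilon>
  proof -
    let ?D = "diag_block_mat (map (\<lambda>i. \<epsilon> powr (2 * \<nu> i) \<cdot>\<^sub>m schur_complement b H i) [0..<Suc p])"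
    have "ase n lam u \<epsilon> = trunc_ase (2 * \<nu> j) n lam u \<epsilon>"
      using ase_eq_trunc_ase inv \<open>j = p\<close> by simp
    \<comment> \<open>For \<open>j = p\<close> the appended zero block has size 0 and leaves the
      matrix unchanged.\<close>
    also have "\<dots> = four_block_mat ?D (0\<^sub>m (dim_row ?D) 0) (0\<^sub>m 0 (dim_col ?D)) (0\<^sub>m 0 0)"
      using \<open>j = p\<close> trunc[OF \<epsilon>] n unfolding diag_block_mat_last Let_def by simp
    also have "\<dots> = ?D" by (intro eq_matI) auto
    finally show ?thesis .
  qed
  with trunc show ?thesis by simp
qed

end
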